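(* Let $\{\Lambda_{w}\in End_{\mathcal{A}}^{\ast}(U,V_{w}) : w\in\Omega\}$ be a continuous $\ast$-g-frame for $U$ with respect to $\{V_w: w\in\Omega\}$, with lower and upper bounds $A$ and $B$, respectively. Let $\Gamma_{w}\in End_{\mathcal{A}}^{\ast}(U,V_{w})$ for each $w\in\Omega$, where for every $x\in U$ the function $w\mapsto\Gamma_w x$ is measurable. Then the following are equivalent: (1) $\{\Gamma_{w}\in End_{\mathcal{A}}^{\ast}(U,V_{w}) : w\in\Omega\}$ is a continuous $\ast$-g-frame for $U$ with respect to $\{V_w: w\in\Omega\}$. (2) There exists a constant $M>0$ such that for every $x\in U$, $$\left\|\int_{\Omega}\langle(\Lambda_{w}-\Gamma_{w})x,(\Lambda_{w}-\Gamma_{w})x\rangle d\mu(w)\right\|\leq M\min\left(\left\|\int_{\Omega}\langle\Lambda_{w}x,\Lambda_{w}x\rangle d\mu(w)\right\|,\ \left\|\int_{\Omega}\langle\Gamma_{w}x,\Gamma_{w}x\rangle d\mu(w)\right\|\right).$$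
   Context: $\mathcal{A}$ is a unital $C^{\ast}$-algebra. Hilbert $\mathcal{A}$-modules are left modules with an $\mathcal{A}$-valued inner product $\langle\cdot,\cdot\rangle$ that is $\mathcal{A}$-linear in the first variable; the norm is $\|x\|=\|\langle x,x\rangle\|^{1/2}$ and the $\mathcal{A}$-valued norm is $|x|=\langle x,x\rangle^{1/2}$. $(\Omega,\mu)$ is a measure space, $U$ and $V$ are Hilbert $\mathcal{A}$-modules, $\{V_{w}: w\in\Omega\}$ is a family of closed $\mathcal{A}$-submodules of $V$, and $End_{\mathcal{A}}^{\ast}(U,V_{w})$ is the set of all adjointable $\mathcal{A}$-linear maps from $U$ into $V_{w}$. Integrals of functions with values in a $C^{\ast}$-algebra or a Hilbert $C^{\ast}$-module are Banach-space-valued (Bochner) integrals; an inequality involving such integrals is understood to include that they exist. Define $$\oplus_{w\in\Omega}V_{w}=\left\{x=\{x_{w}\}_{w\in\Omega}: x_{w}\in V_{w},\ \left\|\int_{\Omega}|x_{w}|^{2}d\mu(w)\right\|<\infty\right\},$$ with $\mathcal{A}$-valued inner product $\langle x,y\rangle=\int_{\Omega}\langle x_{w},y_{w}\rangle d\mu(w)$ and norm $\|x\|=\|\langle x,x\rangle\|^{1/2}$; it is regarded as a Hilbert $\mathcal{A}$-module. An element $a\in\mathcal{A}$ is strictly nonzero if $0$ is not in its spectrum, i.e. $a$ is invertible. A family $\{\Lambda_{w}\in End_{\mathcal{A}}^{\ast}(U,V_{w}): w\in\Omega\}$ is a continuous $\ast$-g-frame for $U$ with respect to $\{V_{w}: w\in\Omega\}$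 if (i) for every $x\in U$ the function $w\mapsto\Lambda_{w}x$ on $\Omega$ (with $\Lambda_w x\in V_w\subseteq V$) is measurable; and (ii) there exist strictly nonzero elements $A,B\in\mathcal{A}$ such that $$A\langle x,x\rangle A^{\ast}\leq\int_{\Omega}\langle\Lambda_{w}x,\Lambda_{w}x\rangle d\mu(w)\leq B\langle x,x\rangle B^{\ast}\quad\text{for all } x\in U.$$ $A$ and $B$ are called the lower and upper bounds of the continuous $\ast$-g-frame. *)

theory Defs
  imports "HOL-Analysis.Analysis"
begin

text \<open>Via \<open>real_normed_algebra_1\<close> a unital C*-algebra is nonzero and \<open>norm 1 = 1\<close>.\<close>

class unital_cstar_algebra = real_normed_algebra_1 + banach +
  fixes scaleC :: "complex \<Rightarrow> 'a \<Rightarrow> 'a" (infixr \<open>*\<^sub>C\<close> 75)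
    and star :: "'a \<Rightarrow> 'a"
  assumes scaleC_add_right: "c *\<^sub>C (a + b) = c *\<^sub>C a + c *\<^sub>C b"
    and scaleC_add_left: "(c + d) *\<^sub>C a = c *\<^sub>C a + d *\<^sub>C a"
    and scaleC_scaleC: "c *\<^sub>C d *\<^sub>C a = (c * d) *\<^sub>C a"
    and scaleC_of_real: "complex_of_real r *\<^sub>C a = r *\<^sub>R a"
    and norm_scaleC: "norm (c *\<^sub>C a) = cmod c * norm a"
    and mult_scaleC_left: "(c *\<^sub>C a) * b = c *\<^sub>C (a * b)"
    and mult_scaleC_right: "a * (c *\<^sub>C b) = c *\<^sub>C (a * b)"
    and star_add: "star (a + b) = star a + star b"
    and star_scaleC: "star (c *\<^sub>C a) = cnj c *\<^sub>C star a"
    and star_mult: "star (a * b) = star b * star a"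
    and star_star: "star (star a) = a"
    and cstar_identity: "norm (star a * a) = (norm a)\<^sup>2"

definition cstar_invertible :: "'a::unital_cstar_algebra \<Rightarrow> bool"
  where "cstar_invertible a \<longleftrightarrow> (\<exists>b. a * b = 1 \<and> b * a = 1)"

definition cstar_spectrum :: "'a::unital_cstar_algebra \<Rightarrow> complex set"
  where "cstar_spectrum a = {z. \<not> cstar_invertible (a - z *\<^sub>C 1)}"

definition strictly_nonzero :: "'a::unital_cstar_algebra \<Rightarrow> bool"
  where "strictly_nonzero a \<longleftrightarrow> 0 \<notin> cstar_spectrum a"

definition cstar_positive :: "'a::unital_cstar_algebra \<Rightarrow> bool"
  where "cstar_positive a \<longleftrightarrow> star a = a \<and> cstar_spectrum a \<subseteq> complex_of_real ` {0..}"

definition cstar_le :: "'a::unital_cstar_algebra \<Rightarrow> 'a \<Rightarrow> bool" (infix \<open>\<preceq>\<close> 50)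
  where "a \<preceq> b \<longleftrightarrow> cstar_positive (b - a)"

text \<open>The vector space structure of the module is the one induced by the action of the unital
  algebra, which is what \<open>act_of_real\<close> says for the real scalars of the type class; a complex
  scalar \<open>c\<close> acts as \<open>act (c *\<^sub>C 1)\<close>. Completeness is part of the class \<open>banach\<close>.\<close>

locale hilbert_cstar_module =
  fixes act :: "'a::unital_cstar_algebra \<Rightarrow> 'm::banach \<Rightarrow> 'm"
    and ip :: "'m \<Rightarrow> 'm \<Rightarrow> 'a"
  assumes act_add_right: "act a (x + y) = act a x + act a y"
    and act_add_left: "act (a + b) x = act a x + act b x"
    and act_act: "act a (act b x) = act (a * b) x"
    and act_one: "act 1 x = x"
    and act_of_real: "act (of_real r) x = r *\<^sub>R x"
    and ip_add_left: "ip (x + y) z = ip x z + ip y z"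
    and ip_act_left: "ip (act a x) y = a * ip x y"
    and ip_star: "star (ip x y) = ip y x"
    and ip_positive: "cstar_positive (ip x x)"
    and ip_definite: "ip x x = 0 \<Longrightarrow> x = 0"
    and norm_eq_sqrt_ip: "norm x = sqrt (norm (ip x x))"

definition closed_submodule :: "('a \<Rightarrow> 'm::banach \<Rightarrow> 'm) \<Rightarrow> 'm set \<Rightarrow> bool"
  where "closed_submodule act W \<longleftrightarrow>
    closed W \<and> 0 \<in> W \<and> (\<forall>x\<in>W. \<forall>y\<in>W. x + y \<in> W) \<and> (\<forall>a. \<forall>x\<in>W. act a x \<in> W)"

text \<open>\<open>T \<in> adjointable_maps actU ipU actV ipV W\<close>: the map \<open>T\<close> is an adjointable linear map
  from \<open>U\<close> into the submodule \<open>W\<close> of \<open>V\<close>. The adjoint is only required on \<open>W\<close>, not on all of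
  \<open>V\<close>.\<close>

definition adjointable_maps ::
    "('a \<Rightarrow> 'u::banach \<Rightarrow> 'u) \<Rightarrow> ('u \<Rightarrow> 'u \<Rightarrow> 'a) \<Rightarrow>
     ('a \<Rightarrow> 'v::banach \<Rightarrow> 'v) \<Rightarrow> ('v \<Rightarrow> 'v \<Rightarrow> 'a) \<Rightarrow> 'v set \<Rightarrow> ('u \<Rightarrow> 'v) set"
  where "adjointable_maps actU ipU actV ipV W = {T.
    (\<forall>x. T x \<in> W) \<and>
    (\<forall>x y. T (x + y) = T x + T y) \<and>
    (\<forall>a x. T (actU a x) = actV a (T x)) \<and>
    (\<exists>S. \<forall>x. \<forall>y\<in>W. ipV (T x) y = ipU x (S y))}"

text \<open>The Bochner integral of the library is restricted to second countable spaces, but C*-algebras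
  and Hilbert modules need not be separable. As usual for Bochner integrals, a function is
  measurable if it is almost everywhere the pointwise limit of a sequence of simple functions. The
  functions inside \<open>\<integral>\<^sup>+\<close> below agree almost everywhere with measurable ones.\<close>

definition strongly_measurable :: "'w measure \<Rightarrow> ('w \<Rightarrow> 'b::real_normed_vector) \<Rightarrow> bool"
  where "strongly_measurable \<mu> f \<longleftrightarrow>
    (\<exists>s :: nat \<Rightarrow> 'w \<Rightarrow> 'b. (\<forall>i. simple_function \<mu> (s i)) \<and>
      (AE w in \<mu>. (\<lambda>i. s i w) \<longlonglongrightarrow> f w))"

definition has_strong_integral ::
    "'w measure \<Rightarrow> ('w \<Rightarrow> 'b::real_normed_vector) \<Rightarrow> 'b \<Rightarrow> bool"
  where "has_strong_integral \<mu> f I \<longleftrightarrow>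
    (\<exists>s :: nat \<Rightarrow> 'w \<Rightarrow> 'b.
      (\<forall>i. Bochner_Integration.simple_bochner_integrable \<mu> (s i)) \<and>
      (AE w in \<mu>. (\<lambda>i. s i w) \<longlonglongrightarrow> f w) \<and>
      (\<lambda>i. \<integral>\<^sup>+w. ennreal (norm (f w - s i w)) \<partial>\<mu>) \<longlonglongrightarrow> 0 \<and>
      (\<lambda>i. Bochner_Integration.simple_bochner_integral \<mu> (s i)) \<longlonglongrightarrow> I)"

definition strongly_integrable :: "'w measure \<Rightarrow> ('w \<Rightarrow> 'b::real_normed_vector) \<Rightarrow> bool"
  where "strongly_integrable \<mu> f \<longleftrightarrow> (\<exists>I. has_strong_integral \<mu> f I)"

definition strong_integral :: "'w measure \<Rightarrow> ('w \<Rightarrow> 'b::real_normed_vector) \<Rightarrow> 'b"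
  where "strong_integral \<mu> f = (THE I. has_strong_integral \<mu> f I)"

text \<open>The index set \<open>\<Omega>\<close> is \<open>space \<mu>\<close>.\<close>

definition continuous_star_g_frame_with_bounds ::
    "'w measure \<Rightarrow>
     ('a::unital_cstar_algebra \<Rightarrow> 'u::banach \<Rightarrow> 'u) \<Rightarrow> ('u \<Rightarrow> 'u \<Rightarrow> 'a) \<Rightarrow>
     ('a \<Rightarrow> 'v::banach \<Rightarrow> 'v) \<Rightarrow> ('v \<Rightarrow> 'v \<Rightarrow> 'a) \<Rightarrow> ('w \<Rightarrow> 'v set) \<Rightarrow>
     ('w \<Rightarrow> 'u \<Rightarrow> 'v) \<Rightarrow> 'a \<Rightarrow> 'a \<Rightarrow> bool"
  where "continuous_star_g_frame_with_bounds \<mu> actU ipU actV ipV V \<Lambda> A B \<longleftrightarrow>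
    (\<forall>w\<in>space \<mu>. \<Lambda> w \<in> adjointable_maps actU ipU actV ipV (V w)) \<and>
    (\<forall>x. strongly_measurable \<mu> (\<lambda>w. \<Lambda> w x)) \<and>
    strictly_nonzero A \<and> strictly_nonzero B \<and>
    (\<forall>x. strongly_integrable \<mu> (\<lambda>w. ipV (\<Lambda> w x) (\<Lambda> w x)) \<and>
      A * ipU x x * star A \<preceq> strong_integral \<mu> (\<lambda>w. ipV (\<Lambda> w x) (\<Lambda> w x)) \<and>
      strong_integral \<mu> (\<lambda>w. ipV (\<Lambda> w x) (\<Lambda> w x)) \<preceq> B * ipU x x * star B)"

definition continuous_star_g_frame ::
    "'w measure \<Rightarrow>
     ('a::unital_cstar_algebra \<Rightarrow> 'u::banach \<Rightarrow> 'u) \<Rightarrow> ('u \<Rightarrow> 'u \<Rightarrow> 'a) \<Rightarrow>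
     ('a \<Rightarrow> 'v::banach \<Rightarrow> 'v) \<Rightarrow> ('v \<Rightarrow> 'v \<Rightarrow> 'a) \<Rightarrow> ('w \<Rightarrow> 'v set) \<Rightarrow>
     ('w \<Rightarrow> 'u \<Rightarrow> 'v) \<Rightarrow> bool"
  where "continuous_star_g_frame \<mu> actU ipU actV ipV V \<Lambda> \<longleftrightarrow>
    (\<exists>A B. continuous_star_g_frame_with_bounds \<mu> actU ipU actV ipV V \<Lambda> A B)"

end

theory Submission
  imports Defs
begin

text \<open>Write \<open>L x\<close>, \<open>G x\<close> and \<open>D x\<close> for the integrals of \<open>\<langle>\<Lambda>\<^sub>w x, \<Lambda>\<^sub>w x\<rangle>\<close>, \<open>\<langle>\<Gamma>\<^sub>w x, \<Gamma>\<^sub>w x\<rangle>\<close> and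
of the same expression for \<open>\<Lambda>\<^sub>w - \<Gamma>\<^sub>w\<close>. Integrating the parallelogram law shows that each of
these three elements has norm at most twice the sum of the norms of the two others
(\<open>norm_strong_integral_diff_le\<close>). Hence the perturbation condition says exactly that \<open>G x\<close>
exists and that its norm is comparable with that of \<open>L x\<close>, uniformly in \<open>x\<close>. As the bounds of a
frame are invertible, the norm of \<open>L x\<close> is comparable with that of \<open>\<langle>x, x\<rangle>\<close>
(\<open>frame_norm_bounds\<close>), and so the condition amounts to the comparability of the norms of \<open>G x\<close>
and \<open>\<langle>x, x\<rangle>\<close>.

It remains to pass from norm inequalities back to inequalities in the algebra, which is done by
\<open>cstar_le_of_norm_le\<close>: if \<open>P\<close> and \<open>Q\<close> are positive quadratic maps on the module with
\<open>P (a x) = a (P x) a\<^sup>*\<close>, likewise for \<open>Q\<close>, and \<open>\<parallel>Q x\<parallel> \<le> K \<parallel>P x\<parallel>\<close> for all \<open>x\<close>, then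
\<open>Q x \<le> K (P x)\<close> for all \<open>x\<close>. One normalises \<open>x\<close> by the inverse \<open>h\<close> of the square root of
\<open>P x + e\<close>, for which \<open>P (h x) \<le> 1\<close> and therefore \<open>Q (h x) \<le> K\<close>; conjugating with the inverse of
\<open>h\<close> and letting the number \<open>e > 0\<close> tend to 0 gives the claim. It is used for both frame bounds,
with the roles of \<open>\<langle>x, x\<rangle>\<close> and \<open>G x\<close> exchanged, and yields frame bounds that are scalars.

This argument needs the order structure of a C*-algebra, where positivity is defined by the
spectrum. It is developed here without Gelfand theory and without the spectral radius formula.
The binomial series gives square roots of \<open>1 - a\<close> for self-adjoint \<open>a\<close> in the unit ball
(\<open>cstar_sqrt\<close>), and from them it follows that \<open>\<parallel>b\<parallel>\<^sup>2 - b\<^sup>2\<close> is never invertible for a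
self-adjoint \<open>b \<noteq> 0\<close> (\<open>norm_sq_minus_square_not_invertible\<close>), which takes the place of the
equality of norm and spectral radius. Positivity thereby becomes a statement about norms, and
equivalent to being the square of a self-adjoint element.

On the side of integration, the main point is that the integral of a function with values in a
closed convex cone lies in that cone (\<open>has_strong_integral_in_closed_cone\<close>).\<close>

section \<open>Invertible elements of a unital C*-algebra\<close>

lemma star_one: "star (1::'a::unital_cstar_algebra) = 1"
  by (metis mult_1 mult_1_right star_mult star_star)

lemma star_scaleR: "star (r *\<^sub>R a) = r *\<^sub>R star (a::'a::unital_cstar_algebra)"
  by (metis complex_cnj_complex_of_real scaleC_of_real star_scaleC)

lemma star_scaleR_one: "star (r *\<^sub>R (1::'a::unital_cstar_algebra)) = r *\<^sub>R 1"
  by (simp add: star_scaleR star_one)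

lemma star_minus: "star (- a) = - star (a::'a::unital_cstar_algebra)"
  using star_scaleR[of "-1" a] by simp

lemma star_diff: "star (a - b) = star a - star (b::'a::unital_cstar_algebra)"
  by (metis diff_conv_add_uminus star_add star_minus)

lemma star_zero: "star (0::'a::unital_cstar_algebra) = 0"
  using star_diff[of 0 0] by simp

lemma scaleC_minus_left: "(- c) *\<^sub>C a = - (c *\<^sub>C (a::'a::unital_cstar_algebra))"
  using scaleC_add_left[of "- c" c a] scaleC_of_real[of 0 a] by (simp add: eq_neg_iff_add_eq_0)

lemma scaleC_diff_right: "c *\<^sub>C (a - b) = c *\<^sub>C a - c *\<^sub>C (b::'a::unital_cstar_algebra)"
  using scaleC_add_right[of c "a - b" b] by simp

lemma scaleC_i_i: "\<i> *\<^sub>C \<i> *\<^sub>C a = - (a::'a::unital_cstar_algebra)"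
  using scaleC_of_real[of "- 1" a] by (simp add: scaleC_scaleC)

lemma norm_star: "norm (star a) = norm (a::'a::unital_cstar_algebra)"
proof -
  have le: "norm b \<le> norm (star b)" for b :: 'a
  proof (cases "b = 0")
    case False
    have "norm b * norm b \<le> norm (star b) * norm b"
      using norm_mult_ineq[of "star b" b] by (simp add: cstar_identity power2_eq_square)
    with False show ?thesis by simp
  qed simp
  from le[of a] le[of "star a"] show ?thesis by (simp add: star_star)
qed

lemma norm_self_mult: "star a = a \<Longrightarrow> norm (a * a) = (norm (a::'a::unital_cstar_algebra))\<^sup>2"
  using cstar_identity[of a] by simp

lemma bounded_linear_star: "bounded_linear (star :: 'a \<Rightarrow> 'a::unital_cstar_algebra)"
  by (rule bounded_linear_intro[where K = 1]) (simp_all add: star_add star_scaleR norm_star)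

lemma star_power: "star (a ^ n) = star (a::'a::unital_cstar_algebra) ^ n"
  by (induction n) (simp_all add: star_one star_mult power_commutes)

lemma cstar_invertible_mult:
  "cstar_invertible a \<Longrightarrow> cstar_invertible b \<Longrightarrow> cstar_invertible (a * b)"
  unfolding cstar_invertible_def
proof (elim exE conjE)
  fix c d assume h: "a * c = 1" "c * a = 1" "b * d = 1" "d * b = 1"
  have "a * b * (d * c) = a * (b * d) * c" "d * c * (a * b) = d * (c * a) * b"
    by (simp_all only: mult.assoc)
  with h show "\<exists>c. a * b * c = 1 \<and> c * (a * b) = 1" by auto
qed

lemma cstar_invertible_scaleR:
  assumes "r \<noteq> 0" shows "cstar_invertible (r *\<^sub>R a) \<longleftrightarrow> cstar_invertible a"
proof -
  have imp: "cstar_invertible (s *\<^sub>R b)" if "s \<noteq> 0" "cstar_invertible b" for s and b :: 'a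
  proof -
    from that(2) obtain c where "b * c = 1" "c * b = 1" unfolding cstar_invertible_def by blast
    with that(1) show ?thesis
      unfolding cstar_invertible_def by (intro exI[of _ "inverse s *\<^sub>R c"]) simp
  qed
  from imp[of r a] imp[of "inverse r" "r *\<^sub>R a"] assms show ?thesis by auto
qed

text \<open>If commuting factors have an invertible product with inverse \<open>c\<close>, then \<open>b c\<close> is a right
inverse and \<open>c b\<close> a left inverse of \<open>a\<close>, and such inverses agree.\<close>

lemma cstar_invertible_factor:
  assumes "cstar_invertible (a * b)" "a * b = b * a"
  shows "cstar_invertible a"
proof -
  from assms(1) obtain c where c: "a * b * c = 1" "c * (a * b) = 1"
    unfolding cstar_invertible_def by blast
  have 1: "a * (b * c) = 1" using c(1) by (simp add: mult.assoc)
  have 2: "c * b * a = 1" using c(2) assms(2) by (simp add: mult.assoc)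
  have "c * b = c * b * (a * (b * c))" using 1 by simp
  also have "\<dots> = (c * b * a) * (b * c)" by (simp add: mult.assoc)
  also have "\<dots> = b * c" using 2 by simp
  finally show ?thesis using 1 2 unfolding cstar_invertible_def by auto
qed

text \<open>The Neumann series of \<open>1 - a\<close> is a two-sided inverse.\<close>

lemma cstar_invertible_near_one:
  fixes a :: "'a::unital_cstar_algebra"
  assumes "norm (1 - a) < 1"
  shows "cstar_invertible a"
proof -
  define x where "x = 1 - a"
  have sm: "summable (\<lambda>n. x ^ n)"
  proof (rule summable_comparison_test)
    show "\<exists>N. \<forall>n\<ge>N. norm (x ^ n) \<le> norm x ^ n" by (simp add: norm_power_ineq)
    show "summable (\<lambda>n. norm x ^ n)" using assms by (simp add: x_def)
  qed
  define S where "S = (\<Sum>n. x ^ n)"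
  have shift: "(\<Sum>n. x ^ Suc n) = S - 1"
    using suminf_split_head[OF sm] by (simp add: S_def)
  have "x * S = S - 1" using suminf_mult[OF sm, of x] shift by (simp add: S_def)
  moreover have "S * x = S - 1"
    using suminf_mult2[OF sm, of x] shift by (simp add: S_def power_Suc2 del: power_Suc)
  ultimately have "(1 - x) * S = 1" "S * (1 - x) = 1" by (simp_all add: algebra_simps)
  then show ?thesis unfolding cstar_invertible_def x_def by auto
qed

lemma cstar_invertible_near_scalar:
  fixes a :: "'a::unital_cstar_algebra"
  assumes "norm (t *\<^sub>R 1 - a) < t"
  shows "cstar_invertible a"
proof -
  have t: "0 < t" using assms norm_ge_zero[of "t *\<^sub>R 1 - a"] by linarith
  have eq: "1 - inverse t *\<^sub>R a = inverse t *\<^sub>R (t *\<^sub>R 1 - a)"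
    using t by (simp add: scaleR_diff_right)
  have "\<bar>inverse t\<bar> * norm (t *\<^sub>R 1 - a) < \<bar>inverse t\<bar> * t"
    using assms t by (intro mult_strict_left_mono) auto
  then have "norm (1 - inverse t *\<^sub>R a) < 1"
    unfolding eq norm_scaleR using t by simp
  then show ?thesis
    using cstar_invertible_near_one[of "inverse t *\<^sub>R a"] cstar_invertible_scaleR[of "inverse t" a] t
    by auto
qed

text \<open>The Taylor coefficients of \<open>t \<mapsto> sqrt (1 - t)\<close> at 0.\<close>

section \<open>Square roots and the norm of self-adjoint elements\<close>

definition sqrt_coeff :: "nat \<Rightarrow> real"
  where "sqrt_coeff n = (- 1) ^ n * ((1/2) gchoose n)"

lemma sqrt_coeff_0: "sqrt_coeff 0 = 1"
  by (simp add: sqrt_coeff_def)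

lemma sqrt_coeff_Suc_nonpos: "sqrt_coeff (Suc n) \<le> 0"
proof -
  have "sqrt_coeff (Suc n) = - (1/2) * pochhammer (1/2) n / fact (Suc n)"
    by (simp add: sqrt_coeff_def gbinomial_pochhammer pochhammer_rec power_mult_distrib[symmetric]
        del: fact_Suc)
  moreover have "pochhammer (1/2::real) n > 0" by (rule pochhammer_pos) simp
  ultimately show ?thesis by (simp del: fact_Suc)
qed

lemma sum_sqrt_coeff_nonneg: "0 \<le> (\<Sum>n\<le>m. sqrt_coeff n)"
proof -
  have "(\<Sum>n\<le>m. sqrt_coeff n) = (- 1) ^ m * ((1/2 - 1) gchoose m)"
    using gbinomial_sum_lower_neg[of "1/2::real" m] by (simp add: sqrt_coeff_def mult.commute)
  also have "\<dots> = pochhammer (1/2) m / fact m"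
    by (simp add: gbinomial_pochhammer power_mult_distrib[symmetric])
  finally show ?thesis using pochhammer_pos[of "1/2::real" m] by simp
qed

text \<open>All coefficients but the first are nonpositive and all partial sums are nonnegative,
which bounds the absolute values of the former by the first coefficient, 1. The series hence
converges absolutely on the whole closed unit ball, boundary included.\<close>

lemma sqrt_coeff_summable:
  shows "summable (\<lambda>n. \<bar>sqrt_coeff n\<bar>)" "(\<Sum>n. \<bar>sqrt_coeff (Suc n)\<bar>) \<le> 1"
proof -
  have le: "(\<Sum>n<m. \<bar>sqrt_coeff (Suc n)\<bar>) \<le> 1" for m
  proof -
    have "(\<Sum>n<m. \<bar>sqrt_coeff (Suc n)\<bar>) = - (\<Sum>n<m. sqrt_coeff (Suc n))"
      by (simp add: sqrt_coeff_Suc_nonpos sum_negf)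
    also have "\<dots> = 1 - (\<Sum>n\<le>m. sqrt_coeff n)"
      by (simp add: lessThan_Suc_atMost[symmetric] sum.lessThan_Suc_shift sqrt_coeff_0
          del: sum.lessThan_Suc)
    finally show ?thesis using sum_sqrt_coeff_nonneg[of m] by simp
  qed
  have sm: "summable (\<lambda>n. \<bar>sqrt_coeff (Suc n)\<bar>)"
    by (rule summableI_nonneg_bounded[OF _ le]) simp
  show "summable (\<lambda>n. \<bar>sqrt_coeff n\<bar>)" using sm summable_Suc_iff[of "\<lambda>n. \<bar>sqrt_coeff n\<bar>"] by blast
  show "(\<Sum>n. \<bar>sqrt_coeff (Suc n)\<bar>) \<le> 1" by (rule suminf_le_const[OF sm le])
qed

text \<open>The square of the power series is \<open>1 - t\<close>: by the Vandermonde identity its coefficients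
are those of \<open>(1 - t)\<close> to the power \<open>1/2 + 1/2\<close>.\<close>

lemma sqrt_coeff_convolution:
  "(\<Sum>i\<le>n. sqrt_coeff i * sqrt_coeff (n - i)) = (if n = 0 then 1 else if n = 1 then - 1 else 0)"
proof -
  have "(\<Sum>i\<le>n. sqrt_coeff i * sqrt_coeff (n - i))
      = (\<Sum>i=0..n. (- 1) ^ n * (((1/2) gchoose i) * ((1/2) gchoose (n - i))))"
    unfolding atMost_atLeast0
  proof (rule sum.cong[OF refl])
    fix i assume "i \<in> {0..n}"
    then have "(- 1::real) ^ n = (- 1) ^ i * (- 1) ^ (n - i)"
      by (simp add: power_add[symmetric])
    then show "sqrt_coeff i * sqrt_coeff (n - i)
        = (- 1) ^ n * (((1/2) gchoose i) * ((1/2) gchoose (n - i)))"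
      by (simp add: sqrt_coeff_def)
  qed
  also have "\<dots> = (- 1) ^ n * (1 gchoose n)"
    using gbinomial_Vandermonde[of "1/2::real" "1/2" n] by (simp add: sum_distrib_left[symmetric])
  also have "\<dots> = (- 1) ^ n * real (1 choose n)"
    by (simp add: binomial_gbinomial)
  finally show ?thesis by (auto simp: binomial_eq_0)
qed

text \<open>The root is the sum of the binomial series in \<open>a\<close>. As a limit of polynomials in \<open>a\<close> it
commutes with everything that commutes with \<open>a\<close>. The bound on \<open>1 - s\<close> expresses, in terms of the
norm, that the root is positive.\<close>

lemma cstar_sqrt:
  fixes a :: "'a::unital_cstar_algebra"
  assumes sa: "star a = a" and n1: "norm a \<le> 1"
  obtains s where "star s = s" "s * s = 1 - a" "norm (1 - s) \<le> 1"
    "\<And>b. b * a = a * b \<Longrightarrow> b * s = s * b"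
proof
  define f where "f n = sqrt_coeff n *\<^sub>R a ^ n" for n
  define s where "s = (\<Sum>n. f n)"
  have nf: "norm (f n) \<le> \<bar>sqrt_coeff n\<bar>" for n
    using order_trans[OF norm_power_ineq power_le_one[OF norm_ge_zero n1]]
    by (auto simp: f_def intro: mult_left_le)
  have smn: "summable (\<lambda>n. norm (f n))"
    by (rule summable_comparison_test'[OF sqrt_coeff_summable(1), of 0]) (simp add: nf)
  have sm: "summable f" by (rule summable_norm_cancel[OF smn])
  have "star s = (\<Sum>n. star (f n))"
    unfolding s_def by (rule bounded_linear.suminf[OF bounded_linear_star sm])
  also have "\<dots> = s" by (simp add: s_def f_def star_scaleR star_power sa)
  finally show "star s = s" .
  have "s * s = (\<Sum>n. \<Sum>i\<le>n. f i * f (n - i))"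
    unfolding s_def by (rule Cauchy_product[OF smn smn])
  also have "\<dots> = (\<Sum>n. (\<Sum>i\<le>n. sqrt_coeff i * sqrt_coeff (n - i)) *\<^sub>R a ^ n)"
    by (simp add: f_def scaleR_sum_left power_add[symmetric] mult.commute)
  also have "\<dots> = (\<Sum>n. if n \<in> {0,1} then (if n = 0 then 1 else - 1) *\<^sub>R a ^ n else 0)"
    unfolding sqrt_coeff_convolution by (intro arg_cong[where f = suminf] ext) auto
  also have "\<dots> = (\<Sum>n\<in>{0,1}. (if n = 0 then 1 else - 1) *\<^sub>R a ^ n)"
    by (subst suminf_finite[of "{0,1}"]) auto
  finally show "s * s = 1 - a" by simp
  have sm': "summable (\<lambda>n. norm (f (Suc n)))" using smn summable_Suc_iff[of "\<lambda>n. norm (f n)"] by blast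
  have f0: "f 0 = 1" by (simp add: f_def sqrt_coeff_0)
  have "s - 1 = (\<Sum>n. f (Suc n))"
    using suminf_split_head[OF sm] f0 by (simp add: s_def)
  then have "norm (1 - s) = norm (\<Sum>n. f (Suc n))" by (metis norm_minus_commute)
  also have "\<dots> \<le> (\<Sum>n. norm (f (Suc n)))" by (rule summable_norm[OF sm'])
  also have "\<dots> \<le> (\<Sum>n. \<bar>sqrt_coeff (Suc n)\<bar>)"
    using sqrt_coeff_summable(1) summable_Suc_iff[of "\<lambda>n. \<bar>sqrt_coeff n\<bar>"]
    by (intro suminf_le[OF _ sm'] nf) blast
  also note sqrt_coeff_summable(2)
  finally show "norm (1 - s) \<le> 1" .
  fix b assume ba: "b * a = a * b"
  have "b * a ^ n = a ^ n * b" for n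
    by (induction n) (simp_all add: mult.assoc[symmetric] ba, metis ba mult.assoc)
  then have "b * f n = f n * b" for n by (simp add: f_def)
  then show "b * s = s * b"
    using suminf_mult[OF sm, of b] suminf_mult2[OF sm, of b] by (simp add: s_def)
qed

text \<open>With \<open>u = b + i q\<close>, the right-hand side is the norm of \<open>u\<^sup>* u\<close>, while \<open>b\<close> is the real
part of \<open>u\<close> and so has norm at most that of \<open>u\<close>.\<close>

lemma norm_sq_le_sum_of_squares:
  fixes b q :: "'a::unital_cstar_algebra"
  assumes b: "star b = b" and q: "star q = q" and comm: "b * q = q * b"
  shows "(norm b)\<^sup>2 \<le> norm (b * b + q * q)"
proof -
  define u where "u = b + \<i> *\<^sub>C q"
  have su: "star u = b - \<i> *\<^sub>C q"
    by (simp add: u_def star_add star_scaleC b q scaleC_minus_left)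
  have "star u * u = (b - \<i> *\<^sub>C q) * (b + \<i> *\<^sub>C q)" unfolding su by (simp only: u_def)
  also have "\<dots> = b * b + q * q"
    by (simp add: distrib_left left_diff_distrib mult_scaleC_left mult_scaleC_right
        scaleC_diff_right scaleC_i_i comm)
  finally have nu: "norm (b * b + q * q) = (norm u)\<^sup>2" using cstar_identity[of u] by simp
  have "b = (1/2) *\<^sub>R (u + star u)" unfolding su by (simp add: u_def scaleR_2[symmetric])
  then have "norm b = norm ((1/2) *\<^sub>R (u + star u))" by (rule arg_cong)
  also have "\<dots> = (1/2) * norm (u + star u)" by (simp del: scaleR_add_right)
  also have "\<dots> \<le> norm u" using norm_triangle_ineq[of u "star u"] by (simp add: norm_star)
  finally show ?thesis unfolding nu by (rule power_mono) simp
qed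

text \<open>If \<open>s\<close> is the root of \<open>1 - b\<^sup>2\<close>, then \<open>s\<^sup>2 + b\<^sup>2 = 1\<close> and \<open>norm_sq_le_sum_of_squares\<close>
bounds \<open>s\<close>.\<close>

lemma norm_one_minus_square_le:
  fixes b :: "'a::unital_cstar_algebra"
  assumes b: "star b = b" and n: "norm b \<le> 1"
  shows "norm (1 - b * b) \<le> 1"
proof -
  have "norm (b * b) \<le> 1" using norm_self_mult[OF b] n by (simp add: power_le_one)
  then obtain s where s: "star s = s" "s * s = 1 - b * b" "b * s = s * b"
    using cstar_sqrt[of "b * b"] b by (metis mult.assoc star_mult)
  have "norm (s * s) \<le> norm (s * s + b * b)"
    using norm_sq_le_sum_of_squares[OF s(1) b] s(3) norm_self_mult[OF s(1)] by simp
  then show ?thesis using s(2) by simp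
qed

lemma inverse_commute:
  fixes x a k :: "'a::monoid_mult"
  assumes "x * a = a * x" "a * k = 1" "k * a = 1"
  shows "x * k = k * x"
  by (metis assms mult.assoc mult_1_left mult_1_right)

text \<open>This replaces the equality of norm and spectral radius: the number \<open>\<parallel>b\<parallel>\<^sup>2\<close> lies in the
spectrum of \<open>b\<^sup>2\<close>. After scaling \<open>b\<close> to an element \<open>c\<close> of norm 1, suppose that \<open>e = 1 - c\<^sup>2\<close> has
an inverse \<open>k\<close>. Then \<open>e\<close> is bounded below by \<open>d = 1 / \<parallel>k\<parallel>\<close> in the sense that
\<open>e - d = e (1 - d k)\<close> is a square \<open>q\<^sup>2\<close>, both factors having square roots. So
\<open>c\<^sup>2 + q\<^sup>2 = 1 - d\<close>, which forces the norm of \<open>c\<close> below 1.\<close>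

lemma norm_sq_minus_square_not_invertible:
  fixes b :: "'a::unital_cstar_algebra"
  assumes b: "star b = b" and nz: "b \<noteq> 0"
  shows "\<not> cstar_invertible ((norm b)\<^sup>2 *\<^sub>R 1 - b * b)"
proof
  assume inv: "cstar_invertible ((norm b)\<^sup>2 *\<^sub>R 1 - b * b)"
  define c where "c = inverse (norm b) *\<^sub>R b"
  have c: "star c = c" "norm c = 1" using b nz by (simp_all add: c_def star_scaleR)
  have "(norm b)\<^sup>2 *\<^sub>R 1 - b * b = (norm b)\<^sup>2 *\<^sub>R (1 - c * c)"
    using nz by (simp add: c_def scaleR_diff_right power2_eq_square field_simps)
  with inv have "cstar_invertible (1 - c * c)"
    using nz cstar_invertible_scaleR[of "(norm b)\<^sup>2" "1 - c * c"] by simp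
  then obtain k where k: "(1 - c * c) * k = 1" "k * (1 - c * c) = 1"
    unfolding cstar_invertible_def by blast
  define e where "e = 1 - c * c"
  note k = k[folded e_def]
  have ce: "c * e = e * c" by (simp add: e_def algebra_simps)
  have se: "star e = e" by (simp add: e_def star_diff star_one star_mult c)
  have "norm e \<le> 1" unfolding e_def using norm_one_minus_square_le[OF c(1)] c(2) by simp
  moreover have "1 \<le> norm e * norm k" using norm_mult_ineq[of e k] k(1) by simp
  ultimately have nk: "1 \<le> norm k"
    by (meson mult_right_le_one_le norm_ge_zero mult_left_le_one_le order_trans)
  have knz: "k \<noteq> 0" using nk by auto
  define d where "d = inverse (norm k)"
  have d: "0 < d" "d \<le> 1" using nk by (auto simp: d_def inverse_le_1_iff)
  have sk: "star k = k"
  proof -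
    have "star k * e = 1" using k(1) se star_mult[of e k] by (simp add: star_one)
    then show ?thesis using k(1) by (metis mult.assoc mult_1_left mult_1_right)
  qed
  have "star (c * c) = c * c" "norm (c * c) \<le> 1"
    using c norm_self_mult[of c] by (simp_all add: star_mult)
  then obtain s where s: "star s = s" "s * s = 1 - c * c" "norm (1 - s) \<le> 1"
      "\<And>x. x * (c * c) = (c * c) * x \<Longrightarrow> x * s = s * x"
    by (rule cstar_sqrt) blast
  have ss: "s * s = e" unfolding s(2) e_def ..
  have "star (d *\<^sub>R k) = d *\<^sub>R k" "norm (d *\<^sub>R k) \<le> 1"
    using nk knz by (simp_all add: star_scaleR sk d_def)
  then obtain r where r: "star r = r" "r * r = 1 - d *\<^sub>R k" "norm (1 - r) \<le> 1"
      "\<And>x. x * (d *\<^sub>R k) = (d *\<^sub>R k) * x \<Longrightarrow> x * r = r * x"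
    by (rule cstar_sqrt) blast
  have cs: "c * s = s * c" by (rule s(4)) (simp add: mult.assoc)
  have "s * e = e * s" by (simp add: ss[symmetric] mult.assoc)
  then have "s * k = k * s" by (rule inverse_commute[OF _ k])
  then have sr: "s * r = r * s" by (intro r(4)) simp
  have "c * k = k * c" by (rule inverse_commute[OF ce k])
  then have cr: "c * r = r * c" by (intro r(4)) simp
  define q where "q = s * r"
  have sq: "star q = q" by (simp add: q_def star_mult s(1) r(1) sr)
  have cq: "c * q = q * c" unfolding q_def by (metis cs cr mult.assoc)
  have "q * q = (s * s) * (r * r)" unfolding q_def by (metis sr mult.assoc)
  also have "\<dots> = e - d *\<^sub>R 1" unfolding ss r(2) by (simp add: right_diff_distrib k)
  finally have "c * c + q * q = (1 - d) *\<^sub>R 1" by (simp add: e_def algebra_simps)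
  then have "1 \<le> \<bar>1 - d\<bar>"
    using norm_sq_le_sum_of_squares[OF c(1) sq cq] c(2) by simp
  with d show False by simp
qed

section \<open>Positive elements\<close>

lemma norm_sq_minus_square_le:
  fixes b :: "'a::unital_cstar_algebra"
  assumes b: "star b = b"
  shows "norm ((norm b)\<^sup>2 *\<^sub>R 1 - b * b) \<le> (norm b)\<^sup>2"
proof (cases "b = 0")
  case nz: False
  define c where "c = inverse (norm b) *\<^sub>R b"
  have c: "star c = c" "norm c = 1" using b nz by (simp_all add: c_def star_scaleR)
  have eq: "(norm b)\<^sup>2 *\<^sub>R 1 - b * b = (norm b)\<^sup>2 *\<^sub>R (1 - c * c)"
    using nz by (simp add: c_def scaleR_diff_right power2_eq_square field_simps)
  show ?thesis
    unfolding eq using norm_one_minus_square_le[OF c(1)] c(2) by (simp add: mult_left_le)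
qed simp

text \<open>Up to scaling, \<open>norm_one_minus_square_le\<close> puts \<open>a\<^sup>2 + t\<close> within distance \<open>\<parallel>a\<parallel>\<^sup>2\<close> of the
larger scalar \<open>\<parallel>a\<parallel>\<^sup>2 + t\<close>.\<close>

lemma square_plus_invertible:
  fixes a :: "'a::unital_cstar_algebra"
  assumes a: "star a = a" and t: "t > 0"
  shows "cstar_invertible (a * a + t *\<^sub>R 1)"
proof (rule cstar_invertible_near_scalar)
  have "norm (((norm a)\<^sup>2 + t) *\<^sub>R 1 - (a * a + t *\<^sub>R 1)) \<le> (norm a)\<^sup>2"
    using norm_sq_minus_square_le[OF a] by (simp add: algebra_simps)
  with t show "norm (((norm a)\<^sup>2 + t) *\<^sub>R 1 - (a * a + t *\<^sub>R 1)) < (norm a)\<^sup>2 + t" by simp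
qed

lemma scaleC_of_real_one: "complex_of_real r *\<^sub>C (1::'a::unital_cstar_algebra) = r *\<^sub>R 1"
  by (rule scaleC_of_real)

text \<open>For \<open>z = r + i t\<close> and \<open>p = a - r\<close>, multiplying \<open>p - i t\<close> by its adjoint \<open>p + i t\<close> gives
the invertible element \<open>p\<^sup>2 + t\<^sup>2\<close>.\<close>

lemma self_adjoint_spectrum_real:
  fixes a :: "'a::unital_cstar_algebra"
  assumes a: "star a = a" and z: "Im z \<noteq> 0"
  shows "cstar_invertible (a - z *\<^sub>C 1)"
proof (rule cstar_invertible_factor)
  define p where "p = a - Re z *\<^sub>R 1"
  define q where "q = (\<i> * complex_of_real (Im z)) *\<^sub>C (1::'a)"
  have sp: "star p = p" by (simp add: p_def star_diff star_scaleR star_one a)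
  have z1: "z *\<^sub>C (1::'a) = Re z *\<^sub>R 1 + q"
    unfolding q_def scaleC_of_real_one[symmetric] scaleC_add_left[symmetric]
    using arg_cong[OF complex_eq[of z], of "\<lambda>c. c *\<^sub>C (1::'a)"] .
  have qq: "q * q = - ((Im z)\<^sup>2 *\<^sub>R 1)"
  proof -
    have "q * q = ((\<i> * complex_of_real (Im z)) * (\<i> * complex_of_real (Im z))) *\<^sub>C 1"
      unfolding q_def by (simp only: mult_scaleC_left mult_scaleC_right scaleC_scaleC mult_1)
    also have "(\<i> * complex_of_real (Im z)) * (\<i> * complex_of_real (Im z)) = complex_of_real (- (Im z)\<^sup>2)"
      by (simp add: power2_eq_square algebra_simps)
    finally show ?thesis unfolding scaleC_of_real_one by simp
  qed
  have qp: "q * x = x * q" for x :: 'a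
    unfolding q_def by (simp only: mult_scaleC_left mult_scaleC_right mult_1 mult_1_right)
  have eq: "a - z *\<^sub>C 1 = p - q" by (simp add: z1 p_def)
  have "(p - q) * (p + q) = p * p + (Im z)\<^sup>2 *\<^sub>R 1" "(p + q) * (p - q) = p * p + (Im z)\<^sup>2 *\<^sub>R 1"
    by (simp_all add: algebra_simps qq qp[of p])
  then show "cstar_invertible ((a - z *\<^sub>C 1) * (p + q))"
    "(a - z *\<^sub>C 1) * (p + q) = (p + q) * (a - z *\<^sub>C 1)"
    unfolding eq using square_plus_invertible[OF sp, of "(Im z)\<^sup>2"] z by simp_all
qed

text \<open>Only the negative real numbers have to be excluded from the spectrum of a self-adjoint
element.\<close>

lemma cstar_positiveI:
  fixes a :: "'a::unital_cstar_algebra"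
  assumes a: "star a = a" and inv: "\<And>t. t > 0 \<Longrightarrow> cstar_invertible (a + t *\<^sub>R 1)"
  shows "cstar_positive a"
  unfolding cstar_positive_def
proof (intro conjI subsetI a)
  fix z assume "z \<in> cstar_spectrum a"
  then have ni: "\<not> cstar_invertible (a - z *\<^sub>C 1)" by (simp add: cstar_spectrum_def)
  then have "Im z = 0" using self_adjoint_spectrum_real[OF a] by blast
  then have z: "z = complex_of_real (Re z)" by (simp add: complex_eq_iff)
  then have "z *\<^sub>C (1::'a) = Re z *\<^sub>R 1" by (metis scaleC_of_real_one)
  with ni inv[of "- Re z"] have "0 \<le> Re z" by (auto simp: not_less[symmetric])
  with z show "z \<in> complex_of_real ` {0..}" by (metis atLeast_iff image_eqI)
qed

lemma cstar_positive_self_adjoint: "cstar_positive a \<Longrightarrow> star a = a"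
  by (simp add: cstar_positive_def)

lemma cstar_positive_plus_invertible:
  fixes a :: "'a::unital_cstar_algebra"
  assumes a: "cstar_positive a" and t: "t > 0"
  shows "cstar_invertible (a + t *\<^sub>R 1)"
proof (rule ccontr)
  assume "\<not> cstar_invertible (a + t *\<^sub>R 1)"
  moreover have "complex_of_real (- t) *\<^sub>C (1::'a) = (- t) *\<^sub>R 1" by (rule scaleC_of_real_one)
  ultimately have "complex_of_real (- t) \<in> cstar_spectrum a"
    by (simp add: cstar_spectrum_def)
  then have "complex_of_real (- t) \<in> complex_of_real ` {0..}"
    using a unfolding cstar_positive_def by blast
  then show False using t by (auto simp del: of_real_minus)
qed

text \<open>Put \<open>b = t - a\<close>. Were \<open>\<parallel>b\<parallel> > t\<close>, then \<open>\<parallel>b\<parallel> - b = a + (\<parallel>b\<parallel> - t)\<close> would be invertible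
because \<open>a\<close> is positive, and \<open>\<parallel>b\<parallel> + b = (\<parallel>b\<parallel> + t) - a\<close> because \<open>a\<close> is small; their product
\<open>\<parallel>b\<parallel>\<^sup>2 - b\<^sup>2\<close> is not invertible.\<close>

lemma cstar_positive_norm_le:
  fixes a :: "'a::unital_cstar_algebra"
  assumes a: "cstar_positive a" and t: "norm a \<le> t"
  shows "norm (t *\<^sub>R 1 - a) \<le> t"
proof (rule ccontr)
  assume "\<not> norm (t *\<^sub>R 1 - a) \<le> t"
  define b where "b = t *\<^sub>R 1 - a"
  then have gt: "norm b > t" using \<open>\<not> _\<close> by simp
  have t0: "0 \<le> t" using t norm_ge_zero order_trans by blast
  have sb: "star b = b"
    by (simp add: b_def star_diff star_scaleR star_one cstar_positive_self_adjoint[OF a])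
  have "cstar_invertible (norm b *\<^sub>R 1 - b)"
    using cstar_positive_plus_invertible[OF a, of "norm b - t"] gt
    by (simp add: b_def algebra_simps)
  moreover have "cstar_invertible (norm b *\<^sub>R 1 + b)"
  proof (rule cstar_invertible_near_scalar)
    show "norm ((norm b + t) *\<^sub>R 1 - (norm b *\<^sub>R 1 + b)) < norm b + t"
      using gt t t0 by (simp add: b_def algebra_simps)
  qed
  ultimately have "cstar_invertible ((norm b *\<^sub>R 1 - b) * (norm b *\<^sub>R 1 + b))"
    by (rule cstar_invertible_mult)
  moreover have "(norm b *\<^sub>R 1 - b) * (norm b *\<^sub>R 1 + b) = (norm b)\<^sup>2 *\<^sub>R 1 - b * b"
    by (simp add: algebra_simps power2_eq_square)
  moreover have "b \<noteq> 0" using gt t0 by auto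
  ultimately show False using norm_sq_minus_square_not_invertible[OF sb] by simp
qed

text \<open>Apply \<open>cstar_sqrt\<close> to \<open>1 - a / t\<close>. The number \<open>u\<close> records that the root again satisfies
the norm criterion for positivity.\<close>

lemma cstar_root_of_norm_le:
  fixes a :: "'a::unital_cstar_algebra"
  assumes a: "star a = a" and t: "norm (t *\<^sub>R 1 - a) \<le> t"
  obtains s u where "star s = s" "s * s = a" "norm (u *\<^sub>R 1 - s) \<le> u"
    "\<And>b. b * a = a * b \<Longrightarrow> b * s = s * b"
proof (cases "t = 0")
  case True
  with t have "a = 0" by simp
  then show ?thesis by (intro that[of 0 0]) (simp_all add: star_zero)
next
  case False
  then have t0: "t > 0" using t norm_ge_zero order_trans by (metis order_less_le)
  define c where "c = inverse t *\<^sub>R (t *\<^sub>R 1 - a)"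
  have c1: "1 - c = inverse t *\<^sub>R a" using t0 by (simp add: c_def scaleR_diff_right)
  have "star c = c" by (simp add: c_def star_diff star_scaleR star_one a)
  moreover have "norm c \<le> 1"
    using t t0 mult_left_mono[OF t, of "inverse t"] by (simp add: c_def)
  ultimately obtain s where s: "star s = s" "s * s = 1 - c" "norm (1 - s) \<le> 1"
    "\<And>b. b * c = c * b \<Longrightarrow> b * s = s * b" by (rule cstar_sqrt) blast
  show ?thesis
  proof (rule that[of "sqrt t *\<^sub>R s" "sqrt t"])
    show "star (sqrt t *\<^sub>R s) = sqrt t *\<^sub>R s" by (simp add: star_scaleR s(1))
    have "sqrt t *\<^sub>R s * sqrt t *\<^sub>R s = t *\<^sub>R (s * s)" using t0 by simp
    also have "\<dots> = a" using t0 by (simp add: s(2) c1)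
    finally show "sqrt t *\<^sub>R s * sqrt t *\<^sub>R s = a" .
    have "sqrt t *\<^sub>R 1 - sqrt t *\<^sub>R s = sqrt t *\<^sub>R (1 - s)" by (simp add: scaleR_diff_right)
    then have "norm (sqrt t *\<^sub>R 1 - sqrt t *\<^sub>R s) = sqrt t * norm (1 - s)" using t0 by simp
    then show "norm (sqrt t *\<^sub>R 1 - sqrt t *\<^sub>R s) \<le> sqrt t"
      using s(3) t0 by (simp add: mult_left_le)
  next
    fix b assume "b * a = a * b"
    then have "b * c = c * b" by (simp add: c_def right_diff_distrib left_diff_distrib)
    then show "b * (sqrt t *\<^sub>R s) = sqrt t *\<^sub>R s * b" using s(4) by simp
  qed
qed

lemma cstar_positive_square: "star s = s \<Longrightarrow> cstar_positive (s * s)"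
  by (rule cstar_positiveI) (simp_all add: star_mult square_plus_invertible)

text \<open>The converse of \<open>cstar_positive_norm_le\<close>. Both together make positivity a condition on
the norm, from which sums and limits of positive elements are easily treated.\<close>

lemma cstar_positive_of_norm_le:
  fixes a :: "'a::unital_cstar_algebra"
  assumes "star a = a" "norm (t *\<^sub>R 1 - a) \<le> t"
  shows "cstar_positive a"
  by (rule cstar_root_of_norm_le[OF assms]) (use cstar_positive_square in blast)

lemma cstar_positive_root:
  fixes a :: "'a::unital_cstar_algebra"
  assumes a: "cstar_positive a"
  obtains s where "cstar_positive s" "s * s = a" "\<And>b. b * a = a * b \<Longrightarrow> b * s = s * b"
proof -
  obtain s u where "star s = s" "s * s = a" "norm (u *\<^sub>R 1 - s) \<le> u"
    "\<And>b. b * a = a * b \<Longrightarrow> b * s = s * b"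
    by (rule cstar_root_of_norm_le[OF cstar_positive_self_adjoint[OF a]
          cstar_positive_norm_le[OF a order_refl]]) blast
  with cstar_positive_of_norm_le that show ?thesis by blast
qed

lemma cstar_positive_add:
  assumes a: "cstar_positive a" and b: "cstar_positive b"
  shows "cstar_positive (a + b)"
proof (rule cstar_positive_of_norm_le)
  show "star (a + b) = a + b" using a b by (simp add: star_add cstar_positive_self_adjoint)
  have "(norm a + norm b) *\<^sub>R 1 - (a + b) = (norm a *\<^sub>R 1 - a) + (norm b *\<^sub>R 1 - b)"
    by (simp add: algebra_simps)
  then show "norm ((norm a + norm b) *\<^sub>R 1 - (a + b)) \<le> norm a + norm b"
    by (metis norm_triangle_mono cstar_positive_norm_le[OF a order_refl]
        cstar_positive_norm_le[OF b order_refl])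
qed

lemma cstar_positive_scaleR:
  assumes a: "cstar_positive a" and r: "r \<ge> 0"
  shows "cstar_positive (r *\<^sub>R a)"
proof -
  obtain s where s: "cstar_positive s" "s * s = a" by (rule cstar_positive_root[OF a])
  have "r *\<^sub>R a = (sqrt r *\<^sub>R s) * (sqrt r *\<^sub>R s)" using r s(2) by simp
  moreover have "star (sqrt r *\<^sub>R s) = sqrt r *\<^sub>R s"
    using cstar_positive_self_adjoint[OF s(1)] by (simp add: star_scaleR)
  ultimately show ?thesis using cstar_positive_square by metis
qed

lemma cstar_positive_zero: "cstar_positive 0"
  using cstar_positive_square[of 0] by (simp add: star_zero)

lemma cstar_positive_scalar: "r \<ge> 0 \<Longrightarrow> cstar_positive (r *\<^sub>R 1)"
  using cstar_positive_square[of 1] cstar_positive_scaleR[of 1 r] by (simp add: star_one)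

text \<open>A convergent sequence is bounded by some \<open>t\<close>, and for this fixed \<open>t\<close> the norm criterion
for positivity is a closed condition.\<close>

lemma closed_cstar_positive: "closed {a :: 'a::unital_cstar_algebra. cstar_positive a}"
  unfolding closed_sequential_limits mem_Collect_eq
proof (intro allI impI, elim conjE)
  fix a :: "nat \<Rightarrow> 'a" and l assume pos: "\<forall>n. cstar_positive (a n)" and lim: "a \<longlonglongrightarrow> l"
  obtain t where t: "\<And>n. norm (a n) \<le> t"
    using convergent_imp_Bseq[OF convergentI[OF lim]] unfolding Bseq_def by blast
  show "cstar_positive l"
  proof (rule cstar_positive_of_norm_le)
    have "(\<lambda>n. star (a n)) \<longlonglongrightarrow> star l" by (rule bounded_linear.tendsto[OF bounded_linear_star lim])
    moreover have "(\<lambda>n. star (a n)) = a" using pos by (simp add: cstar_positive_self_adjoint)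
    ultimately show "star l = l" using LIMSEQ_unique lim by metis
    have "(\<lambda>n. norm (t *\<^sub>R 1 - a n)) \<longlonglongrightarrow> norm (t *\<^sub>R 1 - l)" by (intro tendsto_intros lim)
    then show "norm (t *\<^sub>R 1 - l) \<le> t"
      by (rule LIMSEQ_le_const2) (use pos t cstar_positive_norm_le in blast)
  qed
qed

lemma cstar_positive_scalar_minus:
  assumes a: "cstar_positive a" shows "cstar_positive (norm a *\<^sub>R 1 - a)"
proof (rule cstar_positive_of_norm_le)
  show "star (norm a *\<^sub>R 1 - a) = norm a *\<^sub>R 1 - a"
    using a by (simp add: star_diff star_scaleR star_one cstar_positive_self_adjoint)
  show "norm (norm a *\<^sub>R 1 - (norm a *\<^sub>R 1 - a)) \<le> norm a" by simp
qed

text \<open>Otherwise both \<open>\<parallel>a\<parallel> - a\<close> and \<open>\<parallel>a\<parallel> + a\<close> would be invertible, and so would their product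
\<open>\<parallel>a\<parallel>\<^sup>2 - a\<^sup>2\<close>.\<close>

lemma norm_le_of_cstar_le_scalar:
  fixes a :: "'a::unital_cstar_algebra"
  assumes a: "cstar_positive a" and at: "cstar_positive (t *\<^sub>R 1 - a)" and t: "t \<ge> 0"
  shows "norm a \<le> t"
proof (rule ccontr)
  assume "\<not> norm a \<le> t"
  then have gt: "norm a > t" by simp
  then have nz: "a \<noteq> 0" using t by auto
  have "cstar_invertible (norm a *\<^sub>R 1 - a)"
    using cstar_positive_plus_invertible[OF at, of "norm a - t"] gt by (simp add: algebra_simps)
  moreover have "cstar_invertible (norm a *\<^sub>R 1 + a)"
    using cstar_positive_plus_invertible[OF a, of "norm a"] nz by (simp add: add.commute)
  ultimately have "cstar_invertible ((norm a *\<^sub>R 1 - a) * (norm a *\<^sub>R 1 + a))"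
    by (rule cstar_invertible_mult)
  moreover have "(norm a *\<^sub>R 1 - a) * (norm a *\<^sub>R 1 + a) = (norm a)\<^sup>2 *\<^sub>R 1 - a * a"
    by (simp add: algebra_simps power2_eq_square)
  ultimately show False
    using norm_sq_minus_square_not_invertible[OF cstar_positive_self_adjoint[OF a] nz] by simp
qed

text \<open>From \<open>a \<le> b \<le> \<parallel>b\<parallel>\<close>, reducing the claim to a scalar upper bound.\<close>

lemma cstar_le_norm_mono:
  assumes a: "cstar_positive a" and ab: "a \<preceq> b"
  shows "norm a \<le> norm b"
proof (rule norm_le_of_cstar_le_scalar[OF a])
  have ba: "cstar_positive (b - a)" using ab by (simp add: cstar_le_def)
  have "cstar_positive b" using cstar_positive_add[OF ba a] by simp
  from cstar_positive_add[OF cstar_positive_scalar_minus[OF this] ba]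
  show "cstar_positive (norm b *\<^sub>R 1 - a)" by simp
qed simp

text \<open>If \<open>c\<close> is the inverse of \<open>t - a b\<close>, then \<open>(1 + b c a) / t\<close> is the inverse of \<open>t - b a\<close>.
So \<open>a b\<close> and \<open>b a\<close> have the same nonzero real numbers in their spectra.\<close>

lemma cstar_invertible_swap:
  fixes a b :: "'a::unital_cstar_algebra"
  assumes t: "t \<noteq> 0" and inv: "cstar_invertible (t *\<^sub>R 1 - a * b)"
  shows "cstar_invertible (t *\<^sub>R 1 - b * a)"
proof -
  from inv obtain c where c: "(t *\<^sub>R 1 - a * b) * c = 1" "c * (t *\<^sub>R 1 - a * b) = 1"
    unfolding cstar_invertible_def by blast
  have 1: "a * (b * c) = t *\<^sub>R c - 1" using c(1) by (simp add: algebra_simps)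
  have 2: "c * (a * b) = t *\<^sub>R c - 1" using c(2) by (simp add: algebra_simps)
  define d where "d = inverse t *\<^sub>R (1 + b * c * a)"
  have "b * a * (b * c * a) = b * (a * (b * c)) * a" "b * c * a * (b * a) = b * (c * (a * b)) * a"
    by (simp_all only: mult.assoc)
  then have 3: "b * a * (b * c * a) = t *\<^sub>R (b * c * a) - b * a"
    "b * c * a * (b * a) = t *\<^sub>R (b * c * a) - b * a"
    unfolding 1 2 by (simp_all add: right_diff_distrib left_diff_distrib mult.assoc)
  have "(t *\<^sub>R 1 - b * a) * d = 1"
    unfolding d_def using t 3(1) by (simp add: left_diff_distrib distrib_left)
  moreover have "d * (t *\<^sub>R 1 - b * a) = 1"
    unfolding d_def using t 3(2) by (simp add: right_diff_distrib distrib_right)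
  ultimately show ?thesis unfolding cstar_invertible_def by blast
qed

text \<open>For the real and imaginary parts of \<open>z\<close>, the sum \<open>z z\<^sup>* + z\<^sup>* z\<close> is twice the sum of
their squares and hence positive; subtracting \<open>z\<^sup>* z \<le> 0\<close> shows that \<open>z z\<^sup>*\<close> is positive. If
\<open>z \<noteq> 0\<close>, the number \<open>n = \<parallel>z z\<^sup>*\<parallel> > 0\<close> lies in the spectrum of \<open>z z\<^sup>*\<close> by
\<open>norm_sq_minus_square_not_invertible\<close>, hence in that of \<open>z\<^sup>* z\<close>, which however has no positive
elements.\<close>

lemma star_mult_self_nonpos_imp_zero:
  fixes z :: "'a::unital_cstar_algebra"
  assumes neg: "cstar_positive (- (star z * z))"
  shows "z = 0"
proof (rule ccontr)
  assume nz: "z \<noteq> 0"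
  define n where "n = norm (z * star z)"
  have "n = (norm z)\<^sup>2" using cstar_identity[of "star z"] by (simp add: n_def star_star norm_star)
  then have n0: "n > 0" using nz by simp
  define x where "x = z + star z"
  define w where "w = z - star z"
  have "cstar_positive (x * x)"
    by (rule cstar_positive_square) (simp add: x_def star_scaleR star_add star_star add.commute)
  moreover have "cstar_positive (- (w * w))"
  proof -
    have "star w = - w" by (simp add: w_def star_diff star_star)
    then have "star (\<i> *\<^sub>C w) = \<i> *\<^sub>C w"
      using scaleC_diff_right[of \<i> 0 w] scaleC_diff_right[of \<i> 0 0]
      by (simp add: star_scaleC scaleC_minus_left)
    from cstar_positive_square[OF this] show ?thesis
      by (simp add: mult_scaleC_left mult_scaleC_right scaleC_i_i)
  qed
  ultimately have "cstar_positive ((1/2) *\<^sub>R (x * x + - (w * w)) + - (star z * z))"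
    by (intro cstar_positive_add[OF cstar_positive_scaleR[OF cstar_positive_add] neg]) auto
  moreover have "x * x + - (w * w) = 2 *\<^sub>R (z * star z + star z * z)"
    unfolding x_def w_def scaleR_2 by (simp add: algebra_simps)
  ultimately have pos: "cstar_positive (z * star z)" by simp
  have "cstar_invertible (n *\<^sub>R 1 - star z * z)"
    using cstar_positive_plus_invertible[OF neg n0] by simp
  then have "cstar_invertible (n *\<^sub>R 1 - z * star z)"
    by (rule cstar_invertible_swap[rotated]) (use n0 in simp)
  moreover have "cstar_invertible (n *\<^sub>R 1 + z * star z)"
    using cstar_positive_plus_invertible[OF pos n0] by (simp add: add.commute)
  ultimately have "cstar_invertible ((n *\<^sub>R 1 - z * star z) * (n *\<^sub>R 1 + z * star z))"
    by (rule cstar_invertible_mult)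
  moreover have "(n *\<^sub>R 1 - z * star z) * (n *\<^sub>R 1 + z * star z)
      = n\<^sup>2 *\<^sub>R 1 - (z * star z) * (z * star z)"
    by (simp add: algebra_simps power2_eq_square)
  moreover have "z * star z \<noteq> 0" using n0 by (auto simp: n_def)
  ultimately show False
    using norm_sq_minus_square_not_invertible[OF cstar_positive_self_adjoint[OF pos]]
    by (simp add: n_def)
qed

text \<open>Let \<open>p\<close> be the positive root of \<open>y\<^sup>2\<close> for \<open>y = x\<^sup>* x\<close>, that is, the absolute value of
\<open>y\<close>. Then \<open>m = p - y\<close> is twice the negative part of \<open>y\<close> and \<open>y m = - m p\<close>, so that
\<open>(x m)\<^sup>* (x m) = - m p m\<close> is negative. By the preceding lemma \<open>x m = 0\<close>, which gives \<open>m = 0\<close> and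
\<open>y = p\<close>.\<close>

lemma cstar_positive_star_mult_self:
  fixes x :: "'a::unital_cstar_algebra"
  shows "cstar_positive (star x * x)"
proof -
  define y where "y = star x * x"
  have sy: "star y = y" by (simp add: y_def star_mult star_star)
  obtain p where p: "cstar_positive p" "p * p = y * y"
    "\<And>b. b * (y * y) = y * y * b \<Longrightarrow> b * p = p * b"
    by (rule cstar_positive_root[OF cstar_positive_square[OF sy]]) blast
  have yp: "y * p = p * y" by (rule p(3)) (simp add: mult.assoc)
  have sp: "star p = p" by (rule cstar_positive_self_adjoint[OF p(1)])
  obtain r where r: "cstar_positive r" "r * r = p" "\<And>b. b * p = p * b \<Longrightarrow> b * r = r * b"
    by (rule cstar_positive_root[OF p(1)]) blast
  define m where "m = p - y"
  have sm: "star m = m" by (simp add: m_def star_diff sp sy)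
  have mp: "m * p = p * m" by (simp add: m_def algebra_simps yp)
  have mr: "m * r = r * m" by (rule r(3)[OF mp])
  have my: "y * m = - (m * p)" by (simp add: m_def algebra_simps yp p(2))
  \<comment> \<open>The identities \<open>y m = - m p\<close> and \<open>p = r\<^sup>2\<close> exhibit this product as minus a square.\<close>
  have "star (x * m) * (x * m) = m * (y * m)"
    by (simp add: star_mult sm y_def mult.assoc)
  also have "\<dots> = - ((m * r) * (m * r))"
    unfolding my r(2)[symmetric] by (simp add: mult.assoc) (metis mr mult.assoc)
  finally have eq: "star (x * m) * (x * m) = - ((m * r) * (m * r))" .
  have "star (m * r) = m * r"
    by (simp add: star_mult sm cstar_positive_self_adjoint[OF r(1)] mr)
  then have "cstar_positive (- (star (x * m) * (x * m)))"
    unfolding eq by (simp add: cstar_positive_square)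
  then have "x * m = 0" by (rule star_mult_self_nonpos_imp_zero)
  then have ym: "y * m = 0" by (simp add: y_def mult.assoc)
  then have "m * p = 0" using my by simp
  \<comment> \<open>Here \<open>m\<^sup>2 = m p - m y\<close>, and both products vanish.\<close>
  then have "m * m = 0" using ym mp by (simp add: m_def algebra_simps)
  then have "m = 0" using norm_self_mult[OF sm] by simp
  then have "y = p" by (simp add: m_def)
  then show ?thesis using p(1) by (simp add: y_def)
qed

lemma cstar_positive_conj:
  assumes a: "cstar_positive a"
  shows "cstar_positive (c * a * star c)"
proof -
  obtain s where s: "cstar_positive s" "s * s = a" by (rule cstar_positive_root[OF a])
  have "c * a * star c = star (s * star c) * (s * star c)"
    using cstar_positive_self_adjoint[OF s(1)] s(2)
    by (simp add: star_mult star_star mult.assoc[symmetric]) (simp add: mult.assoc)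
  then show ?thesis by (simp add: cstar_positive_star_mult_self)
qed


section \<open>The Bochner integral without separability\<close>

lemma strongly_measurable_simple: "simple_function \<mu> s \<Longrightarrow> strongly_measurable \<mu> s"
  unfolding strongly_measurable_def by (intro exI[of _ "\<lambda>_. s"]) simp

lemma strongly_measurable_compose2:
  assumes f: "strongly_measurable \<mu> f" and g: "strongly_measurable \<mu> g"
    and p: "\<And>x y u v. u \<longlonglongrightarrow> x \<Longrightarrow> v \<longlonglongrightarrow> y \<Longrightarrow> (\<lambda>i::nat. p (u i) (v i)) \<longlonglongrightarrow> p x y"
  shows "strongly_measurable \<mu> (\<lambda>w. p (f w) (g w))"
proof -
  obtain s where s: "\<And>i. simple_function \<mu> (s i)" "AE w in \<mu>. (\<lambda>i. s i w) \<longlonglongrightarrow> f w"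
    using f unfolding strongly_measurable_def by blast
  obtain t where t: "\<And>i. simple_function \<mu> (t i)" "AE w in \<mu>. (\<lambda>i. t i w) \<longlonglongrightarrow> g w"
    using g unfolding strongly_measurable_def by blast
  have "AE w in \<mu>. (\<lambda>i. p (s i w) (t i w)) \<longlonglongrightarrow> p (f w) (g w)"
    using s(2) t(2) by eventually_elim (rule p)
  with s(1) t(1) show ?thesis
    unfolding strongly_measurable_def
    by (intro exI[of _ "\<lambda>i w. p (s i w) (t i w)"]) (simp add: simple_function_compose2)
qed

lemma strongly_measurable_diff:
  "strongly_measurable \<mu> f \<Longrightarrow> strongly_measurable \<mu> g \<Longrightarrow> strongly_measurable \<mu> (\<lambda>w. f w - g w)"
  by (rule strongly_measurable_compose2[where p = "(-)"]) (auto intro: tendsto_diff)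

text \<open>The norm of \<open>f\<close> need only be measurable up to a null set; replacing it by \<open>g\<close> gives
access to the additivity and the convergence theorems of the Lebesgue integral.\<close>

lemma strongly_measurable_norm:
  assumes "strongly_measurable \<mu> f"
  obtains g where "g \<in> borel_measurable \<mu>" "AE w in \<mu>. ennreal (norm (f w)) = g w"
proof -
  obtain s where s: "\<And>i. simple_function \<mu> (s i)" "AE w in \<mu>. (\<lambda>i. s i w) \<longlonglongrightarrow> f w"
    using assms unfolding strongly_measurable_def by blast
  have [measurable]: "(\<lambda>w. ennreal (norm (s i w))) \<in> borel_measurable \<mu>" for i
    by (intro borel_measurable_simple_function simple_function_compose1[OF s(1)])
  show ?thesis
  proof
    show "(\<lambda>w. liminf (\<lambda>i. ennreal (norm (s i w)))) \<in> borel_measurable \<mu>" by measurable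
    show "AE w in \<mu>. ennreal (norm (f w)) = liminf (\<lambda>i. ennreal (norm (s i w)))"
      using s(2)
    proof eventually_elim
      case (elim w)
      then have "(\<lambda>i. ennreal (norm (s i w))) \<longlonglongrightarrow> ennreal (norm (f w))"
        by (intro tendsto_ennrealI tendsto_norm)
      then show ?case by (intro lim_imp_Liminf[symmetric]) auto
    qed
  qed
qed

lemma nn_integral_norm_add:
  assumes f: "strongly_measurable \<mu> f" and g: "strongly_measurable \<mu> g"
  shows "(\<integral>\<^sup>+w. ennreal (norm (f w)) + ennreal (norm (g w)) \<partial>\<mu>)
    = (\<integral>\<^sup>+w. ennreal (norm (f w)) \<partial>\<mu>) + (\<integral>\<^sup>+w. ennreal (norm (g w)) \<partial>\<mu>)"
proof -
  obtain f' where f': "f' \<in> borel_measurable \<mu>" "AE w in \<mu>. ennreal (norm (f w)) = f' w"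
    using strongly_measurable_norm[OF f] .
  obtain g' where g': "g' \<in> borel_measurable \<mu>" "AE w in \<mu>. ennreal (norm (g w)) = g' w"
    using strongly_measurable_norm[OF g] .
  have "(\<integral>\<^sup>+w. ennreal (norm (f w)) + ennreal (norm (g w)) \<partial>\<mu>) = (\<integral>\<^sup>+w. f' w + g' w \<partial>\<mu>)"
    by (rule nn_integral_cong_AE) (use f'(2) g'(2) in eventually_elim, simp)
  also have "\<dots> = (\<integral>\<^sup>+w. f' w \<partial>\<mu>) + (\<integral>\<^sup>+w. g' w \<partial>\<mu>)"
    by (rule nn_integral_add[OF f'(1) g'(1)])
  also have "(\<integral>\<^sup>+w. f' w \<partial>\<mu>) = (\<integral>\<^sup>+w. ennreal (norm (f w)) \<partial>\<mu>)"
    by (rule nn_integral_cong_AE) (use f'(2) in eventually_elim, simp)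
  also have "(\<integral>\<^sup>+w. g' w \<partial>\<mu>) = (\<integral>\<^sup>+w. ennreal (norm (g w)) \<partial>\<mu>)"
    by (rule nn_integral_cong_AE) (use g'(2) in eventually_elim, simp)
  finally show ?thesis .
qed

lemma nn_integral_norm_le_add:
  assumes f: "strongly_measurable \<mu> f" and g: "strongly_measurable \<mu> g"
    and le: "\<And>w. norm (h w) \<le> norm (f w) + norm (g w)"
  shows "(\<integral>\<^sup>+w. ennreal (norm (h w)) \<partial>\<mu>)
    \<le> (\<integral>\<^sup>+w. ennreal (norm (f w)) \<partial>\<mu>) + (\<integral>\<^sup>+w. ennreal (norm (g w)) \<partial>\<mu>)"
  unfolding nn_integral_norm_add[OF f g, symmetric]
  by (rule nn_integral_mono) (simp add: le ennreal_plus[symmetric] ennreal_leI del: ennreal_plus)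

lemma simple_integrable_strongly_measurable:
  "Bochner_Integration.simple_bochner_integrable \<mu> s \<Longrightarrow> strongly_measurable \<mu> s"
  by (rule strongly_measurable_simple) (auto elim: simple_bochner_integrable.cases)

lemma simple_integral_dist_le:
  assumes s: "Bochner_Integration.simple_bochner_integrable \<mu> s"
    and t: "Bochner_Integration.simple_bochner_integrable \<mu> t"
    and f: "strongly_measurable \<mu> f"
  shows "ennreal (norm (Bochner_Integration.simple_bochner_integral \<mu> s -
      Bochner_Integration.simple_bochner_integral \<mu> t))
    \<le> (\<integral>\<^sup>+w. ennreal (norm (f w - s w)) \<partial>\<mu>) + (\<integral>\<^sup>+w. ennreal (norm (f w - t w)) \<partial>\<mu>)"
proof -
  have d: "Bochner_Integration.simple_bochner_integrable \<mu> (\<lambda>w. s w - t w)"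
    by (rule simple_bochner_integrable_compose2[OF _ s t]) simp
  have nd: "Bochner_Integration.simple_bochner_integrable \<mu> (\<lambda>w. norm (s w - t w))"
    by (rule simple_bochner_integrable_compose2[where p = "\<lambda>x y. norm (x - y)", OF _ s t]) simp
  have "ennreal (norm (Bochner_Integration.simple_bochner_integral \<mu> s -
      Bochner_Integration.simple_bochner_integral \<mu> t))
    \<le> ennreal (Bochner_Integration.simple_bochner_integral \<mu> (\<lambda>w. norm (s w - t w)))"
    unfolding simple_bochner_integral_diff[OF s t, symmetric]
    by (rule ennreal_leI) (rule simple_bochner_integral_norm_bound[OF d])
  also have "\<dots> = (\<integral>\<^sup>+w. ennreal (norm (s w - t w)) \<partial>\<mu>)"
    by (rule simple_bochner_integral_eq_nn_integral[OF nd]) simp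
  also have "\<dots> \<le> (\<integral>\<^sup>+w. ennreal (norm (f w - s w)) \<partial>\<mu>) + (\<integral>\<^sup>+w. ennreal (norm (f w - t w)) \<partial>\<mu>)"
  proof (rule nn_integral_norm_le_add)
    show "strongly_measurable \<mu> (\<lambda>w. f w - s w)" "strongly_measurable \<mu> (\<lambda>w. f w - t w)"
      using s t f by (auto intro: strongly_measurable_diff simple_integrable_strongly_measurable)
    show "norm (s w - t w) \<le> norm (f w - s w) + norm (f w - t w)" for w
      using norm_triangle_ineq4[of "f w - t w" "f w - s w"] by (simp add: add.commute)
  qed
  finally show ?thesis .
qed

lemma has_strong_integral_strongly_measurable:
  "has_strong_integral \<mu> f I \<Longrightarrow> strongly_measurable \<mu> f"
  unfolding has_strong_integral_def strongly_measurable_def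
  by (auto elim: simple_bochner_integrable.cases)

lemma tendsto_zero_ennreal_norm:
  assumes e: "e \<longlonglongrightarrow> 0" and le: "\<And>i. ennreal (norm (x i)) \<le> e i"
  shows "(x :: nat \<Rightarrow> 'b::real_normed_vector) \<longlonglongrightarrow> 0"
proof -
  have "(\<lambda>i. ennreal (norm (x i))) \<longlonglongrightarrow> 0"
    by (rule tendsto_sandwich[OF _ _ tendsto_const e]) (auto simp: le)
  then have "(\<lambda>i. ennreal (norm (x i))) \<longlonglongrightarrow> ennreal 0" by simp
  then have "(\<lambda>i. norm (x i)) \<longlonglongrightarrow> 0" by (subst (asm) tendsto_ennreal_iff) auto
  then show ?thesis by (rule tendsto_norm_zero_cancel)
qed

lemma has_strong_integral_unique:
  assumes I: "has_strong_integral \<mu> f I" and J: "has_strong_integral \<mu> f J"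
  shows "I = J"
proof -
  obtain s where s: "\<And>i. Bochner_Integration.simple_bochner_integrable \<mu> (s i)"
    "(\<lambda>i. \<integral>\<^sup>+w. ennreal (norm (f w - s i w)) \<partial>\<mu>) \<longlonglongrightarrow> 0"
    "(\<lambda>i. Bochner_Integration.simple_bochner_integral \<mu> (s i)) \<longlonglongrightarrow> I"
    using I unfolding has_strong_integral_def by blast
  obtain t where t: "\<And>i. Bochner_Integration.simple_bochner_integrable \<mu> (t i)"
    "(\<lambda>i. \<integral>\<^sup>+w. ennreal (norm (f w - t i w)) \<partial>\<mu>) \<longlonglongrightarrow> 0"
    "(\<lambda>i. Bochner_Integration.simple_bochner_integral \<mu> (t i)) \<longlonglongrightarrow> J"
    using J unfolding has_strong_integral_def by blast
  have "(\<lambda>i. Bochner_Integration.simple_bochner_integral \<mu> (s i) -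
      Bochner_Integration.simple_bochner_integral \<mu> (t i)) \<longlonglongrightarrow> 0"
    by (rule tendsto_zero_ennreal_norm[OF tendsto_add_zero[OF s(2) t(2)]])
      (rule simple_integral_dist_le[OF s(1) t(1) has_strong_integral_strongly_measurable[OF I]])
  moreover have "(\<lambda>i. Bochner_Integration.simple_bochner_integral \<mu> (s i) -
      Bochner_Integration.simple_bochner_integral \<mu> (t i)) \<longlonglongrightarrow> I - J"
    by (rule tendsto_diff[OF s(3) t(3)])
  ultimately show ?thesis using LIMSEQ_unique by fastforce
qed

lemma strong_integral_eq: "has_strong_integral \<mu> f I \<Longrightarrow> strong_integral \<mu> f = I"
  unfolding strong_integral_def by (blast intro: the_equality has_strong_integral_unique)

lemma has_strong_integral_strong_integral:
  "strongly_integrable \<mu> f \<Longrightarrow> has_strong_integral \<mu> f (strong_integral \<mu> f)"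
  unfolding strongly_integrable_def using strong_integral_eq by metis

lemma has_strong_integral_cong:
  assumes "\<And>w. w \<in> space \<mu> \<Longrightarrow> f w = g w"
  shows "has_strong_integral \<mu> f I \<longleftrightarrow> has_strong_integral \<mu> g I"
proof -
  have "(\<integral>\<^sup>+w. ennreal (norm (f w - s w)) \<partial>\<mu>) = (\<integral>\<^sup>+w. ennreal (norm (g w - s w)) \<partial>\<mu>)" for s
    by (rule nn_integral_cong) (simp add: assms)
  moreover have "(AE w in \<mu>. (\<lambda>i. s i w) \<longlonglongrightarrow> f w) \<longleftrightarrow> (AE w in \<mu>. (\<lambda>i. s i w) \<longlonglongrightarrow> g w)"
    for s :: "nat \<Rightarrow> 'a \<Rightarrow> 'b"
    by (rule AE_cong) (simp add: assms)
  ultimately show ?thesis unfolding has_strong_integral_def by simp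
qed

lemma has_strong_integral_add:
  assumes f: "has_strong_integral \<mu> f I" and g: "has_strong_integral \<mu> g J"
  shows "has_strong_integral \<mu> (\<lambda>w. f w + g w) (I + J)"
proof -
  obtain s where s: "\<And>i. Bochner_Integration.simple_bochner_integrable \<mu> (s i)"
    "AE w in \<mu>. (\<lambda>i. s i w) \<longlonglongrightarrow> f w"
    "(\<lambda>i. \<integral>\<^sup>+w. ennreal (norm (f w - s i w)) \<partial>\<mu>) \<longlonglongrightarrow> 0"
    "(\<lambda>i. Bochner_Integration.simple_bochner_integral \<mu> (s i)) \<longlonglongrightarrow> I"
    using f unfolding has_strong_integral_def by blast
  obtain t where t: "\<And>i. Bochner_Integration.simple_bochner_integrable \<mu> (t i)"
    "AE w in \<mu>. (\<lambda>i. t i w) \<longlonglongrightarrow> g w"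
    "(\<lambda>i. \<integral>\<^sup>+w. ennreal (norm (g w - t i w)) \<partial>\<mu>) \<longlonglongrightarrow> 0"
    "(\<lambda>i. Bochner_Integration.simple_bochner_integral \<mu> (t i)) \<longlonglongrightarrow> J"
    using g unfolding has_strong_integral_def by blast
  have le: "(\<integral>\<^sup>+w. ennreal (norm (f w + g w - (s i w + t i w))) \<partial>\<mu>)
      \<le> (\<integral>\<^sup>+w. ennreal (norm (f w - s i w)) \<partial>\<mu>) + (\<integral>\<^sup>+w. ennreal (norm (g w - t i w)) \<partial>\<mu>)" for i
  proof (rule nn_integral_norm_le_add)
    show "strongly_measurable \<mu> (\<lambda>w. f w - s i w)" "strongly_measurable \<mu> (\<lambda>w. g w - t i w)"
      using s(1) t(1) f g
      by (auto intro: strongly_measurable_diff simple_integrable_strongly_measurable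
          has_strong_integral_strongly_measurable)
  qed (rule norm_diff_triangle_ineq)
  show ?thesis
    unfolding has_strong_integral_def
  proof (intro exI conjI allI)
    show "Bochner_Integration.simple_bochner_integrable \<mu> (\<lambda>w. s i w + t i w)" for i
      by (rule simple_bochner_integrable_compose2[OF _ s(1) t(1)]) simp
    show "AE w in \<mu>. (\<lambda>i. s i w + t i w) \<longlonglongrightarrow> f w + g w"
      using s(2) t(2) by eventually_elim (rule tendsto_add)
    show "(\<lambda>i. \<integral>\<^sup>+w. ennreal (norm (f w + g w - (s i w + t i w))) \<partial>\<mu>) \<longlonglongrightarrow> 0"
      by (rule tendsto_sandwich[OF _ _ tendsto_const tendsto_add_zero[OF s(3) t(3)]]) (auto simp: le)
    show "(\<lambda>i. Bochner_Integration.simple_bochner_integral \<mu> (\<lambda>w. s i w + t i w)) \<longlonglongrightarrow> I + J"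
      unfolding simple_bochner_integral_add[OF s(1) t(1)] by (rule tendsto_add[OF s(4) t(4)])
  qed
qed

lemma has_strong_integral_bounded_linear:
  assumes T: "bounded_linear T" and f: "has_strong_integral \<mu> f I"
  shows "has_strong_integral \<mu> (\<lambda>w. T (f w)) (T I)"
proof -
  interpret T: bounded_linear T by fact
  obtain s where s: "\<And>i. Bochner_Integration.simple_bochner_integrable \<mu> (s i)"
    "AE w in \<mu>. (\<lambda>i. s i w) \<longlonglongrightarrow> f w"
    "(\<lambda>i. \<integral>\<^sup>+w. ennreal (norm (f w - s i w)) \<partial>\<mu>) \<longlonglongrightarrow> 0"
    "(\<lambda>i. Bochner_Integration.simple_bochner_integral \<mu> (s i)) \<longlonglongrightarrow> I"
    using f unfolding has_strong_integral_def by blast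
  obtain K where K: "\<And>x. norm (T x) \<le> norm x * K" "K > 0" using T.pos_bounded by blast
  have le: "(\<integral>\<^sup>+w. ennreal (norm (T (f w) - T (s i w))) \<partial>\<mu>)
      \<le> ennreal K * (\<integral>\<^sup>+w. ennreal (norm (f w - s i w)) \<partial>\<mu>)" for i
  proof -
    have "strongly_measurable \<mu> (\<lambda>w. f w - s i w)"
      using s(1) f by (auto intro: strongly_measurable_diff simple_integrable_strongly_measurable
          has_strong_integral_strongly_measurable)
    then obtain g where g: "g \<in> borel_measurable \<mu>" "AE w in \<mu>. ennreal (norm (f w - s i w)) = g w"
      by (rule strongly_measurable_norm)
    have "(\<integral>\<^sup>+w. ennreal (norm (T (f w) - T (s i w))) \<partial>\<mu>) \<le> (\<integral>\<^sup>+w. ennreal K * g w \<partial>\<mu>)"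
    proof (rule nn_integral_mono_AE, use g(2) in eventually_elim)
      fix w assume "ennreal (norm (f w - s i w)) = g w"
      then show "ennreal (norm (T (f w) - T (s i w))) \<le> ennreal K * g w"
        using ennreal_leI[OF K(1)[of "f w - s i w"]] K(2)
        by (simp add: T.diff ennreal_mult mult.commute)
    qed
    also have "\<dots> = ennreal K * (\<integral>\<^sup>+w. g w \<partial>\<mu>)" by (rule nn_integral_cmult[OF g(1)])
    also have "(\<integral>\<^sup>+w. g w \<partial>\<mu>) = (\<integral>\<^sup>+w. ennreal (norm (f w - s i w)) \<partial>\<mu>)"
      by (rule nn_integral_cong_AE) (use g(2) in eventually_elim, simp)
    finally show ?thesis .
  qed
  show ?thesis
    unfolding has_strong_integral_def
  proof (intro exI conjI allI)
    show "Bochner_Integration.simple_bochner_integrable \<mu> (\<lambda>w. T (s i w))" for i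
      by (rule simple_bochner_integrable_compose2[where p = "\<lambda>x y. T x", OF _ s(1) s(1)]) (rule T.zero)
    show "AE w in \<mu>. (\<lambda>i. T (s i w)) \<longlonglongrightarrow> T (f w)"
      using s(2) by eventually_elim (rule T.tendsto)
    have "(\<lambda>i. ennreal K * (\<integral>\<^sup>+w. ennreal (norm (f w - s i w)) \<partial>\<mu>)) \<longlonglongrightarrow> ennreal K * 0"
      by (rule ennreal_tendsto_cmult[OF _ s(3)]) simp
    then have ub: "(\<lambda>i. ennreal K * (\<integral>\<^sup>+w. ennreal (norm (f w - s i w)) \<partial>\<mu>)) \<longlonglongrightarrow> 0" by simp
    show "(\<lambda>i. \<integral>\<^sup>+w. ennreal (norm (T (f w) - T (s i w))) \<partial>\<mu>) \<longlonglongrightarrow> 0"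
      by (rule tendsto_sandwich[OF _ _ tendsto_const ub]) (auto simp: le)
    have "(\<lambda>i. T (Bochner_Integration.simple_bochner_integral \<mu> (s i))) \<longlonglongrightarrow> T I"
      by (rule T.tendsto[OF s(4)])
    then show "(\<lambda>i. Bochner_Integration.simple_bochner_integral \<mu> (\<lambda>w. T (s i w))) \<longlonglongrightarrow> T I"
      using simple_bochner_integral_linear[OF T.linear_axioms s(1)] by simp
  qed
qed

lemma strongly_integrable_imp_bounded:
  assumes f: "strongly_integrable \<mu> f"
  shows "strongly_measurable \<mu> f" "(\<integral>\<^sup>+w. ennreal (norm (f w)) \<partial>\<mu>) < \<infinity>"
proof -
  obtain I where I: "has_strong_integral \<mu> f I" using f unfolding strongly_integrable_def by blast
  show m: "strongly_measurable \<mu> f" by (rule has_strong_integral_strongly_measurable[OF I])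
  obtain s where s: "\<And>i. Bochner_Integration.simple_bochner_integrable \<mu> (s i)"
    "(\<lambda>i. \<integral>\<^sup>+w. ennreal (norm (f w - s i w)) \<partial>\<mu>) \<longlonglongrightarrow> 0"
    using I unfolding has_strong_integral_def by blast
  have "eventually (\<lambda>i. (\<integral>\<^sup>+w. ennreal (norm (f w - s i w)) \<partial>\<mu>) < 1) sequentially"
    by (rule order_tendstoD(2)[OF s(2)]) simp
  then obtain i where i: "(\<integral>\<^sup>+w. ennreal (norm (f w - s i w)) \<partial>\<mu>) < 1"
    using eventually_happens by fastforce
  have nd: "Bochner_Integration.simple_bochner_integrable \<mu> (\<lambda>w. norm (s i w))"
    by (rule simple_bochner_integrable_compose2[where p = "\<lambda>x y. norm x", OF _ s(1) s(1)]) simp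
  have "(\<integral>\<^sup>+w. ennreal (norm (f w)) \<partial>\<mu>)
    \<le> (\<integral>\<^sup>+w. ennreal (norm (f w - s i w)) \<partial>\<mu>) + (\<integral>\<^sup>+w. ennreal (norm (s i w)) \<partial>\<mu>)"
  proof (rule nn_integral_norm_le_add)
    show "strongly_measurable \<mu> (\<lambda>w. f w - s i w)" "strongly_measurable \<mu> (s i)"
      using s(1) m by (auto intro: strongly_measurable_diff simple_integrable_strongly_measurable)
    show "norm (f w) \<le> norm (f w - s i w) + norm (s i w)" for w
      using norm_triangle_ineq[of "f w - s i w" "s i w"] by simp
  qed
  also have "(\<integral>\<^sup>+w. ennreal (norm (s i w)) \<partial>\<mu>)
      = ennreal (Bochner_Integration.simple_bochner_integral \<mu> (\<lambda>w. norm (s i w)))"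
    by (rule simple_bochner_integral_eq_nn_integral[OF nd, symmetric]) simp
  also have "(\<integral>\<^sup>+w. ennreal (norm (f w - s i w)) \<partial>\<mu>) + \<dots> < \<infinity>"
    using i by (simp add: ennreal_add_less_top order_less_trans[OF i ennreal_one_less_top])
  finally show "(\<integral>\<^sup>+w. ennreal (norm (f w)) \<partial>\<mu>) < \<infinity>" .
qed

text \<open>Bochner's criterion. The approximating simple functions \<open>s\<^sub>i\<close> are cut off to 0 where
their norm exceeds \<open>2 \<parallel>f\<parallel>\<close>, which yields functions \<open>t\<^sub>i\<close>. This retains pointwise convergence and
makes \<open>3 \<parallel>f\<parallel>\<close> a dominating function for the norms of \<open>f - t\<^sub>i\<close>. The integrals of the \<open>t\<^sub>i\<close> then
form a Cauchy sequence.\<close>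

lemma strongly_integrableI_bounded:
  fixes f :: "'w \<Rightarrow> 'b::banach"
  assumes m: "strongly_measurable \<mu> f" and fin: "(\<integral>\<^sup>+w. ennreal (norm (f w)) \<partial>\<mu>) < \<infinity>"
  shows "strongly_integrable \<mu> f"
proof -
  obtain s where s: "\<And>i. simple_function \<mu> (s i)" "AE w in \<mu>. (\<lambda>i. s i w) \<longlonglongrightarrow> f w"
    using m unfolding strongly_measurable_def by blast
  obtain g where g[measurable]: "g \<in> borel_measurable \<mu>" and gf: "AE w in \<mu>. ennreal (norm (f w)) = g w"
    using strongly_measurable_norm[OF m] .
  have gfin: "(\<integral>\<^sup>+w. ennreal c * g w \<partial>\<mu>) < \<infinity>" for c
  proof -
    have "(\<integral>\<^sup>+w. g w \<partial>\<mu>) = (\<integral>\<^sup>+w. ennreal (norm (f w)) \<partial>\<mu>)"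
      by (rule nn_integral_cong_AE) (use gf in eventually_elim, simp)
    with fin show ?thesis by (simp add: nn_integral_cmult ennreal_mult_less_top)
  qed
  have [measurable]: "(\<lambda>w. ennreal (norm (s i w))) \<in> borel_measurable \<mu>" for i
    by (intro borel_measurable_simple_function simple_function_compose1[OF s(1)])
  define t where "t i w = (if ennreal (norm (s i w)) \<le> ennreal 2 * g w then s i w else 0)" for i w
  have tsimple: "simple_function \<mu> (t i)" for i
    unfolding t_def by (rule simple_function_If[OF s(1)]) simp_all
  have tle: "ennreal (norm (t i w)) \<le> ennreal 2 * g w" for i w
    by (simp add: t_def)
  have t: "Bochner_Integration.simple_bochner_integrable \<mu> (t i)" for i
  proof (rule simple_bochner_integrableI_bounded[OF tsimple])
    show "(\<integral>\<^sup>+w. ennreal (norm (t i w)) \<partial>\<mu>) < \<infinity>"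
      by (rule le_less_trans[OF nn_integral_mono gfin[of 2]]) (rule tle)
  qed
  have tlim: "AE w in \<mu>. (\<lambda>i. t i w) \<longlonglongrightarrow> f w"
    using s(2) gf
  proof eventually_elim
    fix w assume lim: "(\<lambda>i. s i w) \<longlonglongrightarrow> f w" and fg: "ennreal (norm (f w)) = g w"
    show "(\<lambda>i. t i w) \<longlonglongrightarrow> f w"
    proof (cases "f w = 0")
      case True
      then have "t i w = 0" for i using tle[of i w] fg[symmetric] by simp
      with True show ?thesis by simp
    next
      case False
      then have "eventually (\<lambda>i. norm (s i w) < 2 * norm (f w)) sequentially"
        by (intro order_tendstoD(2)[OF tendsto_norm[OF lim]]) simp
      then have "eventually (\<lambda>i. s i w = t i w) sequentially"
      proof eventually_elim
        case (elim i)
        then have "ennreal (norm (s i w)) \<le> ennreal (2 * norm (f w))" by (intro ennreal_leI) simp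
        then show ?case unfolding t_def fg[symmetric] by (simp add: ennreal_mult)
      qed
      with lim show ?thesis by (rule Lim_transform_eventually)
    qed
  qed
  have lim0: "(\<lambda>i. \<integral>\<^sup>+w. ennreal (norm (f w - t i w)) \<partial>\<mu>) \<longlonglongrightarrow> 0"
  proof -
    have "\<exists>h. h \<in> borel_measurable \<mu> \<and> (AE w in \<mu>. ennreal (norm (f w - t i w)) = h w)" for i
      using strongly_measurable_norm[OF strongly_measurable_diff[OF m
            simple_integrable_strongly_measurable[OF t]]] by metis
    then obtain h where h: "\<And>i. h i \<in> borel_measurable \<mu>"
      "\<And>i. AE w in \<mu>. ennreal (norm (f w - t i w)) = h i w" by metis
    have "(\<lambda>i. \<integral>\<^sup>+w. h i w \<partial>\<mu>) \<longlonglongrightarrow> (\<integral>\<^sup>+w. 0 \<partial>\<mu>)"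
    proof (rule nn_integral_dominated_convergence[where w = "\<lambda>w. ennreal 3 * g w"])
      show "AE w in \<mu>. h i w \<le> ennreal 3 * g w" for i
        using h(2)[of i] gf
      proof eventually_elim
        fix w assume hw: "ennreal (norm (f w - t i w)) = h i w" and fg: "ennreal (norm (f w)) = g w"
        have "norm (t i w) \<le> 2 * norm (f w)"
          using tle[of i w] unfolding fg[symmetric]
          by (simp add: ennreal_mult[symmetric] del: ennreal_numeral)
        then have "norm (f w - t i w) \<le> 3 * norm (f w)"
          using norm_triangle_ineq4[of "f w" "t i w"] by simp
        then have "ennreal (norm (f w - t i w)) \<le> ennreal (3 * norm (f w))" by (rule ennreal_leI)
        then show "h i w \<le> ennreal 3 * g w"
          unfolding hw[symmetric] fg[symmetric] by (simp add: ennreal_mult)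
      qed
      have "AE w in \<mu>. \<forall>i. ennreal (norm (f w - t i w)) = h i w"
        using h(2) by (simp add: AE_all_countable)
      then show "AE w in \<mu>. (\<lambda>i. h i w) \<longlonglongrightarrow> 0"
        using tlim
      proof eventually_elim
        fix w assume hw: "\<forall>i. ennreal (norm (f w - t i w)) = h i w" and "(\<lambda>i. t i w) \<longlonglongrightarrow> f w"
        then have "(\<lambda>i. norm (f w - t i w)) \<longlonglongrightarrow> norm (f w - f w)" by (intro tendsto_intros)
        then have "(\<lambda>i. ennreal (norm (f w - t i w))) \<longlonglongrightarrow> ennreal (norm (f w - f w))"
          by (rule tendsto_ennrealI)
        then show "(\<lambda>i. h i w) \<longlonglongrightarrow> 0" using hw by simp
      qed
    qed (use h(1) gfin[of 3] in auto)
    moreover have "(\<integral>\<^sup>+w. h i w \<partial>\<mu>) = (\<integral>\<^sup>+w. ennreal (norm (f w - t i w)) \<partial>\<mu>)" for i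
      by (rule nn_integral_cong_AE) (use h(2)[of i] in eventually_elim, simp)
    ultimately show ?thesis by simp
  qed
  have "Cauchy (\<lambda>i. Bochner_Integration.simple_bochner_integral \<mu> (t i))"
  proof (rule metric_CauchyI)
    fix e :: real assume e: "e > 0"
    have "eventually (\<lambda>i. (\<integral>\<^sup>+w. ennreal (norm (f w - t i w)) \<partial>\<mu>) < ennreal (e/3)) sequentially"
      by (rule order_tendstoD(2)[OF lim0]) (use e in simp)
    then obtain N where N: "\<And>i. i \<ge> N \<Longrightarrow> (\<integral>\<^sup>+w. ennreal (norm (f w - t i w)) \<partial>\<mu>) < ennreal (e/3)"
      unfolding eventually_sequentially by blast
    show "\<exists>N. \<forall>i\<ge>N. \<forall>j\<ge>N. dist (Bochner_Integration.simple_bochner_integral \<mu> (t i))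
        (Bochner_Integration.simple_bochner_integral \<mu> (t j)) < e"
    proof (intro exI allI impI)
      fix i j assume ij: "i \<ge> N" "j \<ge> N"
      have "ennreal (norm (Bochner_Integration.simple_bochner_integral \<mu> (t i) -
        Bochner_Integration.simple_bochner_integral \<mu> (t j))) \<le> ennreal (e/3) + ennreal (e/3)"
        by (rule order_trans[OF simple_integral_dist_le[OF t t m]
              add_mono[OF less_imp_le[OF N[OF ij(1)]] less_imp_le[OF N[OF ij(2)]]]])
      also have "\<dots> = ennreal (e/3 + e/3)" using e by (intro ennreal_plus[symmetric]) auto
      also have "\<dots> < ennreal e" using e by (intro ennreal_lessI) auto
      finally show "dist (Bochner_Integration.simple_bochner_integral \<mu> (t i))
        (Bochner_Integration.simple_bochner_integral \<mu> (t j)) < e"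
        by (simp add: dist_norm ennreal_less_iff)
    qed
  qed
  then obtain I where "(\<lambda>i. Bochner_Integration.simple_bochner_integral \<mu> (t i)) \<longlonglongrightarrow> I"
    using Cauchy_convergent convergentD by blast
  then show ?thesis
    unfolding strongly_integrable_def has_strong_integral_def
    by (intro exI[of _ I] exI[of _ t] conjI allI t tlim lim0)
qed

text \<open>Instead of separating a point from the cone by a functional, push the approximating
simple functions into the cone: send each value \<open>v\<close> to a point \<open>\<pi> v\<close> of the cone that is at most
twice as far away as any other. As the values of \<open>f\<close> belong to the cone, the approximation error
grows at most by the factor 3, and the integral of a simple function with values in the cone is
a finite sum of elements of the cone.\<close>

lemma has_strong_integral_in_closed_cone:
  assumes f: "has_strong_integral \<mu> f I" and fP: "\<And>w. w \<in> space \<mu> \<Longrightarrow> f w \<in> P"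
    and cl: "closed P" and zero: "0 \<in> P" and add: "\<And>x y. x \<in> P \<Longrightarrow> y \<in> P \<Longrightarrow> x + y \<in> P"
    and scale: "\<And>r x. r \<ge> 0 \<Longrightarrow> x \<in> P \<Longrightarrow> r *\<^sub>R x \<in> P"
  shows "I \<in> P"
proof -
  have "\<exists>p\<in>P. \<forall>q\<in>P. norm (v - p) \<le> 2 * norm (v - q)" for v
  proof (cases "v \<in> P")
    case True
    then show ?thesis by (intro bexI[of _ v]) auto
  next
    case False
    then have "infdist v P \<noteq> 0" using in_closed_iff_infdist_zero[OF cl] zero by blast
    then have pos: "infdist v P > 0" using infdist_nonneg[of v P] by linarith
    have "\<exists>p\<in>P. dist v p < 2 * infdist v P"
    proof (rule ccontr)
      assume "\<not> ?thesis"
      then have "2 * infdist v P \<le> infdist v P"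
        using zero by (subst (2) infdist_notempty) (auto intro!: cINF_greatest simp: not_less)
      with pos show False by simp
    qed
    then obtain p where p: "p \<in> P" "dist v p < 2 * infdist v P" by blast
    show ?thesis
    proof (intro bexI[OF _ p(1)] ballI)
      fix q assume "q \<in> P"
      then have "infdist v P \<le> dist v q" by (rule infdist_le)
      with p(2) show "norm (v - p) \<le> 2 * norm (v - q)" by (simp add: dist_norm)
    qed
  qed
  then have "\<exists>\<pi>. \<forall>v. \<pi> v \<in> P \<and> (\<forall>q\<in>P. norm (v - \<pi> v) \<le> 2 * norm (v - q))"
    unfolding Bex_def by (intro choice allI)
  then obtain \<pi> where \<pi>: "\<And>v. \<pi> v \<in> P" "\<And>v q. q \<in> P \<Longrightarrow> norm (v - \<pi> v) \<le> 2 * norm (v - q)"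
    by blast
  have \<pi>0: "\<pi> 0 = 0" using \<pi>(2)[OF zero, of 0] by simp
  obtain s where s: "\<And>i. Bochner_Integration.simple_bochner_integrable \<mu> (s i)"
    "(\<lambda>i. \<integral>\<^sup>+w. ennreal (norm (f w - s i w)) \<partial>\<mu>) \<longlonglongrightarrow> 0"
    "(\<lambda>i. Bochner_Integration.simple_bochner_integral \<mu> (s i)) \<longlonglongrightarrow> I"
    using f unfolding has_strong_integral_def by blast
  have m: "strongly_measurable \<mu> f" by (rule has_strong_integral_strongly_measurable[OF f])
  have ps: "Bochner_Integration.simple_bochner_integrable \<mu> (\<lambda>w. \<pi> (s i w))" for i
    by (rule simple_bochner_integrable_compose2[where p = "\<lambda>x y. \<pi> x", OF _ s(1) s(1)]) (rule \<pi>0)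
  have le: "(\<integral>\<^sup>+w. ennreal (norm (f w - \<pi> (s i w))) \<partial>\<mu>)
      \<le> 3 * (\<integral>\<^sup>+w. ennreal (norm (f w - s i w)) \<partial>\<mu>)" for i
  proof -
    obtain g where g: "g \<in> borel_measurable \<mu>" "AE w in \<mu>. ennreal (norm (f w - s i w)) = g w"
      using strongly_measurable_norm[OF strongly_measurable_diff[OF m
            simple_integrable_strongly_measurable[OF s(1)]]] .
    have "(\<integral>\<^sup>+w. ennreal (norm (f w - \<pi> (s i w))) \<partial>\<mu>) \<le> (\<integral>\<^sup>+w. ennreal 3 * g w \<partial>\<mu>)"
    proof (rule nn_integral_mono_AE, use g(2) AE_space in eventually_elim)
      fix w assume gw: "ennreal (norm (f w - s i w)) = g w" and w: "w \<in> space \<mu>"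
      have "norm (f w - \<pi> (s i w)) \<le> norm (f w - s i w) + norm (s i w - \<pi> (s i w))"
        using norm_triangle_ineq[of "f w - s i w" "s i w - \<pi> (s i w)"] by simp
      also have "\<dots> \<le> 3 * norm (f w - s i w)"
        using \<pi>(2)[OF fP[OF w], of "s i w"] by (simp add: norm_minus_commute)
      finally have "ennreal (norm (f w - \<pi> (s i w))) \<le> ennreal (3 * norm (f w - s i w))"
        by (rule ennreal_leI)
      then show "ennreal (norm (f w - \<pi> (s i w))) \<le> ennreal 3 * g w"
        unfolding gw[symmetric] by (simp add: ennreal_mult)
    qed
    also have "\<dots> = 3 * (\<integral>\<^sup>+w. g w \<partial>\<mu>)" using nn_integral_cmult[OF g(1)] by simp
    also have "(\<integral>\<^sup>+w. g w \<partial>\<mu>) = (\<integral>\<^sup>+w. ennreal (norm (f w - s i w)) \<partial>\<mu>)"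
      by (rule nn_integral_cong_AE) (use g(2) in eventually_elim, simp)
    finally show ?thesis .
  qed
  have "(\<lambda>i. ennreal 3 * (\<integral>\<^sup>+w. ennreal (norm (f w - s i w)) \<partial>\<mu>)) \<longlonglongrightarrow> ennreal 3 * 0"
    by (rule ennreal_tendsto_cmult[OF _ s(2)]) simp
  then have ub: "(\<lambda>i. 3 * (\<integral>\<^sup>+w. ennreal (norm (f w - s i w)) \<partial>\<mu>)) \<longlonglongrightarrow> 0" by simp
  have lim0: "(\<lambda>i. \<integral>\<^sup>+w. ennreal (norm (f w - \<pi> (s i w))) \<partial>\<mu>) \<longlonglongrightarrow> 0"
    by (rule tendsto_sandwich[OF _ _ tendsto_const ub]) (auto simp: le)
  have "(\<lambda>i. Bochner_Integration.simple_bochner_integral \<mu> (\<lambda>w. \<pi> (s i w)) -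
      Bochner_Integration.simple_bochner_integral \<mu> (s i)) \<longlonglongrightarrow> 0"
    by (rule tendsto_zero_ennreal_norm[OF tendsto_add_zero[OF lim0 s(2)]])
      (rule simple_integral_dist_le[OF ps s(1) m])
  from tendsto_add[OF this s(3)]
  have "(\<lambda>i. Bochner_Integration.simple_bochner_integral \<mu> (\<lambda>w. \<pi> (s i w))) \<longlonglongrightarrow> I" by simp
  moreover have "\<forall>i. Bochner_Integration.simple_bochner_integral \<mu> (\<lambda>w. \<pi> (s i w)) \<in> P"
  proof
    fix i
    have sum: "(\<forall>y\<in>F. h y \<in> P) \<Longrightarrow> sum h F \<in> P" if "finite F" for F and h :: "'b \<Rightarrow> 'b"
      using that by induction (auto simp: zero add)
    have "finite ((\<lambda>w. \<pi> (s i w)) ` space \<mu>)"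
      using ps[of i] by (auto elim: simple_bochner_integrable.cases simp: simple_function_def)
    then show "Bochner_Integration.simple_bochner_integral \<mu> (\<lambda>w. \<pi> (s i w)) \<in> P"
      unfolding simple_bochner_integral_def by (rule sum) (auto intro!: scale \<pi>(1))
  qed
  ultimately show ?thesis using cl unfolding closed_sequential_limits by metis
qed

section \<open>Hilbert modules and square-integrable functions\<close>

context hilbert_cstar_module
begin

lemma ip_add_right: "ip x (y + z) = ip x y + ip x z"
  by (metis ip_add_left ip_star star_add)

lemma ip_act_right: "ip x (act a y) = ip x y * star a"
  by (metis ip_act_left ip_star star_mult)

lemma ip_scaleR_left: "ip (r *\<^sub>R x) y = r *\<^sub>R ip x y"
  using ip_act_left[of "of_real r" x y] unfolding act_of_real by (simp add: of_real_def)

lemma ip_scaleR_right: "ip x (r *\<^sub>R y) = r *\<^sub>R ip x y"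
  by (metis ip_scaleR_left ip_star star_scaleR)

lemma ip_minus_left: "ip (- x) y = - ip x y"
  using ip_scaleR_left[of "- 1" x y] by simp

lemma ip_minus_right: "ip x (- y) = - ip x y"
  using ip_scaleR_right[of x "- 1" y] by simp

lemma ip_diff_left: "ip (x - y) z = ip x z - ip y z"
  using ip_add_left[of x "- y" z] by (simp add: ip_minus_left)

lemma ip_diff_right: "ip x (y - z) = ip x y - ip x z"
  using ip_add_right[of x y "- z"] by (simp add: ip_minus_right)

lemma norm_ip_self: "norm (ip x x) = (norm x)\<^sup>2"
  by (simp add: norm_eq_sqrt_ip)

lemma parallelogram:
  "2 *\<^sub>R ip x x + 2 *\<^sub>R ip y y - ip (x - y) (x - y) = ip (x + y) (x + y)"
  by (simp add: ip_add_left ip_add_right ip_diff_left ip_diff_right scaleR_2 algebra_simps)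

text \<open>Polarization expresses the left-hand side through two values of the quadratic form.\<close>

lemma norm_ip_add_swap: "norm (ip x y + ip y x) \<le> (norm x + norm y)\<^sup>2"
proof -
  have "2 *\<^sub>R (ip x y + ip y x) = ip (x + y) (x + y) - ip (x - y) (x - y)"
    by (simp add: ip_add_left ip_add_right ip_diff_left ip_diff_right scaleR_2 algebra_simps)
  then have "2 * norm (ip x y + ip y x) = norm (ip (x + y) (x + y) - ip (x - y) (x - y))"
    by (metis norm_scaleR abs_numeral)
  also have "\<dots> \<le> (norm (x + y))\<^sup>2 + (norm (x - y))\<^sup>2"
    using norm_triangle_ineq4[of "ip (x + y) (x + y)" "ip (x - y) (x - y)"] by (simp add: norm_ip_self)
  also have "\<dots> \<le> (norm x + norm y)\<^sup>2 + (norm x + norm y)\<^sup>2"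
    by (intro add_mono power_mono norm_triangle_ineq norm_triangle_ineq4) auto
  finally show ?thesis by simp
qed

text \<open>Apply \<open>norm_ip_add_swap\<close> to \<open>x, y\<close> and to \<open>x, i y\<close>; the sum and the difference of
\<open>\<langle>x, y\<rangle>\<close> and \<open>\<langle>y, x\<rangle>\<close> are then both bounded.\<close>

lemma norm_ip_le_sum_sq: "norm (ip x y) \<le> (norm x + norm y)\<^sup>2"
proof -
  define j where "j = \<i> *\<^sub>C (1::'a)"
  have sj: "star j = - j" by (simp add: j_def star_scaleC star_one scaleC_minus_left)
  have jz: "j * z = \<i> *\<^sub>C z" "z * j = \<i> *\<^sub>C z" for z :: 'a
    by (simp_all add: j_def mult_scaleC_left mult_scaleC_right)
  have "ip (act j y) (act j y) = - (j * (ip y y * j))"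
    by (simp add: ip_act_left ip_act_right sj mult.assoc)
  also have "\<dots> = ip y y" by (simp add: jz scaleC_i_i)
  finally have "norm (act j y) = norm y" by (simp add: norm_eq_sqrt_ip)
  then have "norm (ip x (act j y) + ip (act j y) x) \<le> (norm x + norm y)\<^sup>2"
    using norm_ip_add_swap[of x "act j y"] by simp
  moreover have "ip x (act j y) + ip (act j y) x = - j * (ip x y - ip y x)"
    by (simp add: ip_act_left ip_act_right sj jz right_diff_distrib)
  moreover have "norm (- j * (ip x y - ip y x)) = norm (ip x y - ip y x)"
    by (simp add: jz norm_scaleC)
  ultimately have "norm (ip x y - ip y x) \<le> (norm x + norm y)\<^sup>2" by simp
  moreover have "2 *\<^sub>R ip x y = (ip x y - ip y x) + (ip x y + ip y x)" by (simp add: scaleR_2)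
  then have "2 * norm (ip x y) \<le> norm (ip x y - ip y x) + norm (ip x y + ip y x)"
    by (metis norm_scaleR abs_numeral norm_triangle_ineq)
  ultimately show ?thesis using norm_ip_add_swap[of x y] by linarith
qed

text \<open>Scaling both arguments to norm 1 in \<open>norm_ip_le_sum_sq\<close> gives the constant 4.\<close>

lemma bounded_bilinear_ip: "bounded_bilinear ip"
proof
  show "\<exists>K. \<forall>x y. norm (ip x y) \<le> norm x * norm y * K"
  proof (intro exI allI)
    fix x y
    show "norm (ip x y) \<le> norm x * norm y * 4"
    proof (cases "x = 0 \<or> y = 0")
      case True
      then show ?thesis using ip_scaleR_left[of 0 x y] ip_scaleR_right[of x 0 y] by auto
    next
      case False
      define x' y' where "x' = inverse (norm x) *\<^sub>R x" and "y' = inverse (norm y) *\<^sub>R y"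
      have "norm x' = 1" "norm y' = 1" using False by (simp_all add: x'_def y'_def)
      then have "norm (ip x' y') \<le> 4" using norm_ip_le_sum_sq[of x' y'] by simp
      moreover have "norm x * norm y * (inverse (norm y) * inverse (norm x)) = 1"
        using False by (simp add: divide_simps)
      then have "ip x y = (norm x * norm y) *\<^sub>R ip x' y'"
        by (simp add: x'_def y'_def ip_scaleR_left ip_scaleR_right)
      ultimately show ?thesis by (simp add: mult_left_mono)
    qed
  qed
qed (simp_all add: ip_add_left ip_add_right ip_scaleR_left ip_scaleR_right)

lemma strongly_measurable_ip_self:
  "strongly_measurable \<mu> f \<Longrightarrow> strongly_measurable \<mu> (\<lambda>w. ip (f w) (f w))"
  by (rule strongly_measurable_compose2[where p = "\<lambda>x y. ip x x"])
    (auto intro: bounded_bilinear.tendsto[OF bounded_bilinear_ip])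

text \<open>The positive elements form a closed convex cone.\<close>

lemma strong_integral_ip_self_positive:
  assumes "has_strong_integral \<mu> (\<lambda>w. ip (f w) (f w)) I"
  shows "cstar_positive I"
  using has_strong_integral_in_closed_cone[OF assms, of "{a. cstar_positive a}"]
  by (simp add: ip_positive closed_cstar_positive cstar_positive_zero cstar_positive_add
      cstar_positive_scaleR)

text \<open>By the parallelogram law, \<open>2 I + 2 J - D\<close> is the integral of \<open>\<langle>f + g, f + g\<rangle>\<close> and so is
positive.\<close>

lemma norm_strong_integral_diff_le:
  assumes f: "has_strong_integral \<mu> (\<lambda>w. ip (f w) (f w)) I"
    and g: "has_strong_integral \<mu> (\<lambda>w. ip (g w) (g w)) J"
    and d: "has_strong_integral \<mu> (\<lambda>w. ip (f w - g w) (f w - g w)) D"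
  shows "norm D \<le> 2 * norm I + 2 * norm J"
proof -
  have "has_strong_integral \<mu>
      (\<lambda>w. 2 *\<^sub>R ip (f w) (f w) + 2 *\<^sub>R ip (g w) (g w) + - ip (f w - g w) (f w - g w))
      (2 *\<^sub>R I + 2 *\<^sub>R J + - D)"
    by (intro has_strong_integral_add has_strong_integral_bounded_linear[OF bounded_linear_scaleR_right]
        has_strong_integral_bounded_linear[OF bounded_linear_minus[OF bounded_linear_ident]] f g d)
  then have "has_strong_integral \<mu> (\<lambda>w. ip (f w + g w) (f w + g w)) (2 *\<^sub>R I + 2 *\<^sub>R J - D)"
    by (simp add: parallelogram)
  then have "D \<preceq> 2 *\<^sub>R I + 2 *\<^sub>R J"
    unfolding cstar_le_def by (rule strong_integral_ip_self_positive)
  then have "norm D \<le> norm (2 *\<^sub>R I + 2 *\<^sub>R J)"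
    by (rule cstar_le_norm_mono[OF strong_integral_ip_self_positive[OF d]])
  also have "\<dots> \<le> 2 * norm I + 2 * norm J"
    using norm_triangle_ineq[of "2 *\<^sub>R I" "2 *\<^sub>R J"] by simp
  finally show ?thesis .
qed

lemma strongly_integrable_ip_diff:
  assumes mf: "strongly_measurable \<mu> f" and mg: "strongly_measurable \<mu> g"
    and f: "strongly_integrable \<mu> (\<lambda>w. ip (f w) (f w))"
    and g: "strongly_integrable \<mu> (\<lambda>w. ip (g w) (g w))"
  shows "strongly_integrable \<mu> (\<lambda>w. ip (f w - g w) (f w - g w))"
proof (rule strongly_integrableI_bounded)
  show "strongly_measurable \<mu> (\<lambda>w. ip (f w - g w) (f w - g w))"
    by (rule strongly_measurable_ip_self[OF strongly_measurable_diff[OF mf mg]])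
  have 2: "strongly_integrable \<mu> (\<lambda>w. 2 *\<^sub>R h w)" if "strongly_integrable \<mu> h" for h :: "_ \<Rightarrow> 'a"
    using that has_strong_integral_bounded_linear[OF bounded_linear_scaleR_right]
    unfolding strongly_integrable_def by blast
  have "(\<integral>\<^sup>+w. ennreal (norm (ip (f w - g w) (f w - g w))) \<partial>\<mu>)
    \<le> (\<integral>\<^sup>+w. ennreal (norm (2 *\<^sub>R ip (f w) (f w))) \<partial>\<mu>) + (\<integral>\<^sup>+w. ennreal (norm (2 *\<^sub>R ip (g w) (g w))) \<partial>\<mu>)"
  proof (rule nn_integral_norm_le_add)
    fix w
    have "(norm (f w - g w))\<^sup>2 \<le> (norm (f w) + norm (g w))\<^sup>2"
      by (rule power_mono[OF norm_triangle_ineq4]) simp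
    also have "\<dots> \<le> 2 * (norm (f w))\<^sup>2 + 2 * (norm (g w))\<^sup>2"
      using zero_le_power2[of "norm (f w) - norm (g w)"] by (simp add: power2_eq_square algebra_simps)
    finally show "norm (ip (f w - g w) (f w - g w))
        \<le> norm (2 *\<^sub>R ip (f w) (f w)) + norm (2 *\<^sub>R ip (g w) (g w))"
      by (simp add: norm_ip_self)
  qed (rule strongly_integrable_imp_bounded(1)[OF 2[OF f]] strongly_integrable_imp_bounded(1)[OF 2[OF g]])+
  also have "\<dots> < \<infinity>"
    using strongly_integrable_imp_bounded(2)[OF 2[OF f]] strongly_integrable_imp_bounded(2)[OF 2[OF g]]
    by simp
  finally show "(\<integral>\<^sup>+w. ennreal (norm (ip (f w - g w) (f w - g w))) \<partial>\<mu>) < \<infinity>" .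
qed

end

text \<open>The typical instances are \<open>P x = \<langle>x, x\<rangle>\<close> and \<open>Q x\<close> the integral of \<open>\<langle>T\<^sub>w x, T\<^sub>w x\<rangle>\<close> for
linear maps \<open>T\<^sub>w\<close>, or these two exchanged. The norm condition is invoked only at \<open>h x\<close>, where
\<open>h\<close> is the inverse of the square root \<open>g\<close> of \<open>P x + e\<close>; the summand \<open>e\<close> is there because \<open>P x\<close>
need not be invertible.\<close>

section \<open>From norm inequalities to inequalities in the algebra\<close>

lemma cstar_le_of_norm_le:
  fixes P Q :: "'u \<Rightarrow> 'a::unital_cstar_algebra" and act :: "'a \<Rightarrow> 'u \<Rightarrow> 'u"
  assumes posP: "\<And>x. cstar_positive (P x)" and posQ: "\<And>x. cstar_positive (Q x)"
    and actP: "\<And>a x. P (act a x) = a * P x * star a" and actQ: "\<And>a x. Q (act a x) = a * Q x * star a"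
    and le: "\<And>x. norm (Q x) \<le> K * norm (P x)" and K: "K \<ge> 0"
  shows "Q x \<preceq> K *\<^sub>R P x"
proof -
  have pos: "cstar_positive (K *\<^sub>R (P x + e *\<^sub>R 1) - Q x)" if e: "e > 0" for e
  proof -
    have "cstar_positive (P x + e *\<^sub>R 1)"
      using e by (intro cstar_positive_add posP cstar_positive_scalar) simp
    then obtain g where g: "cstar_positive g" "g * g = P x + e *\<^sub>R 1" by (rule cstar_positive_root)
    have sg: "star g = g" by (rule cstar_positive_self_adjoint[OF g(1)])
    have "cstar_invertible g"
      by (rule cstar_invertible_factor[of g g])
        (simp_all add: g(2) cstar_positive_plus_invertible[OF posP e])
    then obtain h where h: "g * h = 1" "h * g = 1" unfolding cstar_invertible_def by blast
    have sh: "star h = h"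
    proof -
      have "star h * g = 1" using h(1) sg star_mult[of g h] by (simp add: star_one)
      then show ?thesis using h(1) by (metis mult.assoc mult_1_left mult_1_right)
    qed
    have "h * (g * g) * h = (h * g) * (g * h)" by (simp only: mult.assoc)
    then have "h * (P x + e *\<^sub>R 1) * h = 1" unfolding g(2) h by simp
    \<comment> \<open>\<open>h (P x) h = h (g\<^sup>2 - e) h = 1 - e h\<^sup>2\<close>\<close>
    then have "1 *\<^sub>R 1 - P (act h x) = e *\<^sub>R (h * h)"
      by (simp add: actP sh algebra_simps)
    moreover have "cstar_positive (e *\<^sub>R (h * h))"
      using e by (intro cstar_positive_scaleR cstar_positive_square sh) simp
    ultimately have "norm (P (act h x)) \<le> 1"
      using norm_le_of_cstar_le_scalar[OF posP, of 1 "act h x"] by simp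
    then have "norm (Q (act h x)) \<le> K"
      using order_trans[OF le mult_left_mono[OF _ K, of "norm (P (act h x))" 1]] by simp
    then have "cstar_positive ((K - norm (Q (act h x))) *\<^sub>R 1 + (norm (Q (act h x)) *\<^sub>R 1 - Q (act h x)))"
      by (intro cstar_positive_add cstar_positive_scalar cstar_positive_scalar_minus posQ) simp
    then have "cstar_positive (K *\<^sub>R 1 - Q (act h x))" by (simp add: algebra_simps)
    then have "cstar_positive (g * (K *\<^sub>R 1 - Q (act h x)) * star g)" by (rule cstar_positive_conj)
    moreover have "g * (K *\<^sub>R 1 - Q (act h x)) * star g = K *\<^sub>R (g * g) - (g * h) * Q x * (h * g)"
      unfolding actQ sh sg by (simp add: right_diff_distrib left_diff_distrib mult.assoc)
    ultimately show ?thesis unfolding g(2) h by simp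
  qed
  have lim: "(\<lambda>n. K *\<^sub>R (P x + inverse (real (Suc n)) *\<^sub>R 1) - Q x) \<longlonglongrightarrow> K *\<^sub>R (P x + 0 *\<^sub>R 1) - Q x"
    by (intro tendsto_intros LIMSEQ_inverse_real_of_nat)
  have "K *\<^sub>R (P x + 0 *\<^sub>R 1) - Q x \<in> {a. cstar_positive a}"
    by (rule closed_sequentially[OF closed_cstar_positive _ lim]) (use pos in simp)
  then show ?thesis by (simp add: cstar_le_def)
qed

section \<open>Frame inequalities and norm inequalities\<close>

lemma strictly_nonzero_iff: "strictly_nonzero (a::'a::unital_cstar_algebra) \<longleftrightarrow> cstar_invertible a"
  using scaleC_of_real[of 0 "1::'a"] by (simp add: strictly_nonzero_def cstar_spectrum_def)

lemma strictly_nonzero_scalar: "r \<noteq> 0 \<Longrightarrow> strictly_nonzero (r *\<^sub>R 1)"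
  unfolding strictly_nonzero_iff cstar_invertible_def by (intro exI[of _ "inverse r *\<^sub>R 1"]) simp

text \<open>Since \<open>\<langle>a y, a y\<rangle> = a \<langle>y, y\<rangle> a\<^sup>*\<close>, this is the bounded linear map \<open>y \<mapsto> a y a\<^sup>*\<close> applied
under the integral.\<close>

lemma strong_integral_ip_act:
  assumes V: "hilbert_cstar_module actV ipV"
    and lin: "\<And>w. w \<in> space \<mu> \<Longrightarrow> T w (actU a x) = actV a (T w x)"
    and int: "has_strong_integral \<mu> (\<lambda>w. ipV (T w x) (T w x)) I"
  shows "has_strong_integral \<mu> (\<lambda>w. ipV (T w (actU a x)) (T w (actU a x))) (a * I * star a)"
proof -
  interpret V: hilbert_cstar_module actV ipV by fact
  have "bounded_linear (\<lambda>y. a * y * star a)"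
    by (intro bounded_linear_mult_left[THEN bounded_linear_compose] bounded_linear_mult_right)
  from has_strong_integral_bounded_linear[OF this int] show ?thesis
    by (subst has_strong_integral_cong[where g = "\<lambda>w. a * ipV (T w x) (T w x) * star a"])
      (simp_all add: lin V.ip_act_left V.ip_act_right mult.assoc)
qed

lemma continuous_star_g_frame_with_boundsD:
  assumes "continuous_star_g_frame_with_bounds \<mu> actU ipU actV ipV V \<Lambda> A B"
  shows "strictly_nonzero A"
    "strongly_measurable \<mu> (\<lambda>w. \<Lambda> w x)"
    "strongly_integrable \<mu> (\<lambda>w. ipV (\<Lambda> w x) (\<Lambda> w x))"
    "A * ipU x x * star A \<preceq> strong_integral \<mu> (\<lambda>w. ipV (\<Lambda> w x) (\<Lambda> w x))"
    "strong_integral \<mu> (\<lambda>w. ipV (\<Lambda> w x) (\<Lambda> w x)) \<preceq> B * ipU x x * star B"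
  using assms unfolding continuous_star_g_frame_with_bounds_def by simp_all

text \<open>The upper inequality follows by monotonicity of the norm. For the lower one, \<open>\<langle>x, x\<rangle>\<close> is
recovered from \<open>A \<langle>x, x\<rangle> A\<^sup>*\<close> by conjugation with the inverse of \<open>A\<close>. Adding 1 to the constants
keeps them strictly positive.\<close>

lemma frame_norm_bounds:
  assumes U: "hilbert_cstar_module actU ipU"
    and fr: "continuous_star_g_frame_with_bounds \<mu> actU ipU actV ipV V \<Lambda> A B"
  obtains a b where "a > 0" "b > 0"
    "\<forall>x. norm (ipU x x) \<le> a * norm (strong_integral \<mu> (\<lambda>w. ipV (\<Lambda> w x) (\<Lambda> w x)))"
    "\<forall>x. norm (strong_integral \<mu> (\<lambda>w. ipV (\<Lambda> w x) (\<Lambda> w x))) \<le> b * norm (ipU x x)"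
proof -
  interpret U: hilbert_cstar_module actU ipU by fact
  let ?S = "\<lambda>x. strong_integral \<mu> (\<lambda>w. ipV (\<Lambda> w x) (\<Lambda> w x))"
  note lo = continuous_star_g_frame_with_boundsD(4)[OF fr]
    and up = continuous_star_g_frame_with_boundsD(5)[OF fr]
  have conj_norm: "norm (c * y * star c) \<le> (norm c)\<^sup>2 * norm y" for c y :: 'a
  proof -
    have "norm (c * y * star c) \<le> norm (c * y) * norm c"
      using norm_mult_ineq[of "c * y" "star c"] by (simp add: norm_star)
    also have "\<dots> \<le> (norm c * norm y) * norm c"
      by (rule mult_right_mono[OF norm_mult_ineq]) simp
    finally show ?thesis by (simp add: power2_eq_square mult_ac)
  qed
  have posA: "cstar_positive (A * ipU x x * star A)" for x
    by (rule cstar_positive_conj[OF U.ip_positive])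
  have posS: "cstar_positive (?S x)" for x
    using cstar_positive_add[OF posA[of x] lo[of x, unfolded cstar_le_def]] by simp
  obtain C where C: "C * A = 1"
    using continuous_star_g_frame_with_boundsD(1)[OF fr]
    unfolding strictly_nonzero_iff cstar_invertible_def by blast
  show ?thesis
  proof (rule that[of "(norm C)\<^sup>2 + 1" "(norm B)\<^sup>2 + 1"]; (intro allI)?)
    fix x
    have "norm (?S x) \<le> norm (B * ipU x x * star B)" by (rule cstar_le_norm_mono[OF posS up])
    also have "\<dots> \<le> (norm B)\<^sup>2 * norm (ipU x x)" by (rule conj_norm)
    also have "\<dots> \<le> ((norm B)\<^sup>2 + 1) * norm (ipU x x)" by (intro mult_right_mono) auto
    finally show "norm (?S x) \<le> ((norm B)\<^sup>2 + 1) * norm (ipU x x)" .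
    have "star A * star C = 1" using C star_mult[of C A] by (simp add: star_one)
    then have "ipU x x = (C * A) * ipU x x * (star A * star C)" using C by simp
    also have "\<dots> = C * (A * ipU x x * star A) * star C" by (simp only: mult.assoc)
    finally have "norm (ipU x x) \<le> (norm C)\<^sup>2 * norm (A * ipU x x * star A)"
      using conj_norm[of C "A * ipU x x * star A"] by simp
    also have "\<dots> \<le> (norm C)\<^sup>2 * norm (?S x)"
      by (intro mult_left_mono cstar_le_norm_mono posA lo) simp
    also have "\<dots> \<le> ((norm C)\<^sup>2 + 1) * norm (?S x)" by (intro mult_right_mono) auto
    finally show "norm (ipU x x) \<le> ((norm C)\<^sup>2 + 1) * norm (?S x)" .
  qed (auto intro: add_nonneg_pos)
qed

text \<open>Two applications of \<open>cstar_le_of_norm_le\<close> give \<open>a\<^sup>-\<^sup>1 \<langle>x, x\<rangle> \<le> S x \<le> b \<langle>x, x\<rangle>\<close>; the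
square roots of the two numbers, as multiples of 1, serve as frame bounds.\<close>

lemma frame_of_norm_bounds:
  assumes U: "hilbert_cstar_module actU ipU" and V: "hilbert_cstar_module actV ipV"
    and adj: "\<forall>w\<in>space \<mu>. T w \<in> adjointable_maps actU ipU actV ipV (V w)"
    and meas: "\<forall>x. strongly_measurable \<mu> (\<lambda>w. T w x)"
    and int: "\<And>x. strongly_integrable \<mu> (\<lambda>w. ipV (T w x) (T w x))"
    and a: "a > 0" "\<And>x. norm (ipU x x) \<le> a * norm (strong_integral \<mu> (\<lambda>w. ipV (T w x) (T w x)))"
    and b: "b > 0" "\<And>x. norm (strong_integral \<mu> (\<lambda>w. ipV (T w x) (T w x))) \<le> b * norm (ipU x x)"
  shows "continuous_star_g_frame \<mu> actU ipU actV ipV V T"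
proof -
  interpret U: hilbert_cstar_module actU ipU by fact
  interpret V: hilbert_cstar_module actV ipV by fact
  define S where "S x = strong_integral \<mu> (\<lambda>w. ipV (T w x) (T w x))" for x
  note a = a[folded S_def] and b = b[folded S_def]
  have hasS: "has_strong_integral \<mu> (\<lambda>w. ipV (T w x) (T w x)) (S x)" for x
    unfolding S_def by (rule has_strong_integral_strong_integral[OF int])
  have posS: "cstar_positive (S x)" for x by (rule V.strong_integral_ip_self_positive[OF hasS])
  have actS: "S (actU c x) = c * S x * star c" for c x
  proof -
    have "T w (actU c x) = actV c (T w x)" if "w \<in> space \<mu>" for w
      using adj that unfolding adjointable_maps_def by blast
    then have "has_strong_integral \<mu> (\<lambda>w. ipV (T w (actU c x)) (T w (actU c x))) (c * S x * star c)"
      by (rule strong_integral_ip_act[where T = T, OF V _ hasS])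
    then show ?thesis unfolding S_def[of "actU c x"] by (rule strong_integral_eq)
  qed
  have actU: "ipU (actU c x) (actU c x) = c * ipU x x * star c" for c x
    by (simp add: U.ip_act_left U.ip_act_right mult.assoc)
  have up: "S x \<preceq> b *\<^sub>R ipU x x" for x
    by (rule cstar_le_of_norm_le[where act = actU, OF U.ip_positive posS actU actS b(2)])
      (use b(1) in simp)
  have lo: "ipU x x \<preceq> a *\<^sub>R S x" for x
    by (rule cstar_le_of_norm_le[where act = actU and Q = "\<lambda>x. ipU x x",
          OF posS U.ip_positive actS actU a(2)]) (use a(1) in simp)
  have lo': "inverse a *\<^sub>R ipU x x \<preceq> S x" for x
    using cstar_positive_scaleR[OF lo[of x, unfolded cstar_le_def], of "inverse a"] a(1)
    by (simp add: cstar_le_def scaleR_diff_right)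
  have sc: "(sqrt r *\<^sub>R 1) * y * star (sqrt r *\<^sub>R 1) = r *\<^sub>R y" if "r > 0" for r and y :: 'a
    using that by (simp add: star_scaleR_one)
  show ?thesis
    unfolding continuous_star_g_frame_def continuous_star_g_frame_with_bounds_def
  proof (intro exI conjI allI adj[rule_format] ballI meas[rule_format] int)
    show "strictly_nonzero (sqrt (inverse a) *\<^sub>R (1::'a))" "strictly_nonzero (sqrt b *\<^sub>R (1::'a))"
      using a(1) b(1) by (auto intro!: strictly_nonzero_scalar)
    fix x
    show "sqrt (inverse a) *\<^sub>R 1 * ipU x x * star (sqrt (inverse a) *\<^sub>R 1)
        \<preceq> strong_integral \<mu> (\<lambda>w. ipV (T w x) (T w x))"
      using lo'[of x] a(1) unfolding S_def[symmetric] by (subst sc) auto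
    show "strong_integral \<mu> (\<lambda>w. ipV (T w x) (T w x)) \<preceq> sqrt b *\<^sub>R 1 * ipU x x * star (sqrt b *\<^sub>R 1)"
      using up[of x] b(1) unfolding S_def[symmetric] by (subst sc) auto
  qed
qed

text \<open>With \<open>a, b\<close> and \<open>c, d\<close> comparing the norm of \<open>\<langle>x, x\<rangle>\<close> with those of \<open>L x\<close> and \<open>G x\<close>, two
frames satisfy \<open>\<parallel>L x\<parallel> \<le> b c \<parallel>G x\<parallel>\<close> and \<open>\<parallel>G x\<parallel> \<le> d a \<parallel>L x\<parallel>\<close>, which turns
\<open>\<parallel>D x\<parallel> \<le> 2 \<parallel>L x\<parallel> + 2 \<parallel>G x\<parallel>\<close> into the perturbation condition. Conversely, that condition bounds
\<open>D x\<close> by either of the other two integrals, so each of these is at most \<open>2 + 2 M\<close> times the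
other in norm.\<close>

theorem theorem3p2:
  fixes \<mu> :: "'w measure"
    and actU :: "'a::unital_cstar_algebra \<Rightarrow> 'u::banach \<Rightarrow> 'u" and ipU :: "'u \<Rightarrow> 'u \<Rightarrow> 'a"
    and actV :: "'a \<Rightarrow> 'v::banach \<Rightarrow> 'v" and ipV :: "'v \<Rightarrow> 'v \<Rightarrow> 'a"
    and V :: "'w \<Rightarrow> 'v set"
    and \<Lambda> \<Gamma> :: "'w \<Rightarrow> 'u \<Rightarrow> 'v"
    and A B :: 'a
  assumes "hilbert_cstar_module actU ipU"
    and "hilbert_cstar_module actV ipV"
    and "\<forall>w\<in>space \<mu>. closed_submodule actV (V w)"
    and "continuous_star_g_frame_with_bounds \<mu> actU ipU actV ipV V \<Lambda> A B"
    and "\<forall>w\<in>space \<mu>. \<Gamma> w \<in> adjointable_maps actU ipU actV ipV (V w)"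
    and "\<forall>x. strongly_measurable \<mu> (\<lambda>w. \<Gamma> w x)"
  shows "continuous_star_g_frame \<mu> actU ipU actV ipV V \<Gamma> \<longleftrightarrow>
    (\<exists>M::real. M > 0 \<and> (\<forall>x.
      strongly_integrable \<mu> (\<lambda>w. ipV (\<Lambda> w x - \<Gamma> w x) (\<Lambda> w x - \<Gamma> w x)) \<and>
      strongly_integrable \<mu> (\<lambda>w. ipV (\<Lambda> w x) (\<Lambda> w x)) \<and>
      strongly_integrable \<mu> (\<lambda>w. ipV (\<Gamma> w x) (\<Gamma> w x)) \<and>
      norm (strong_integral \<mu> (\<lambda>w. ipV (\<Lambda> w x - \<Gamma> w x) (\<Lambda> w x - \<Gamma> w x)))
        \<le> M * min (norm (strong_integral \<mu> (\<lambda>w. ipV (\<Lambda> w x) (\<Lambda> w x))))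
                  (norm (strong_integral \<mu> (\<lambda>w. ipV (\<Gamma> w x) (\<Gamma> w x))))))"
    (is "?frame \<longleftrightarrow> (\<exists>M::real. M > 0 \<and> ?perturb M)")
proof -
  interpret V: hilbert_cstar_module actV ipV by fact
  let ?D = "\<lambda>x. strong_integral \<mu> (\<lambda>w. ipV (\<Lambda> w x - \<Gamma> w x) (\<Lambda> w x - \<Gamma> w x))"
  let ?L = "\<lambda>x. strong_integral \<mu> (\<lambda>w. ipV (\<Lambda> w x) (\<Lambda> w x))"
  let ?G = "\<lambda>x. strong_integral \<mu> (\<lambda>w. ipV (\<Gamma> w x) (\<Gamma> w x))"
  note measL = continuous_star_g_frame_with_boundsD(2)[OF assms(4)]
    and intL = continuous_star_g_frame_with_boundsD(3)[OF assms(4)]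
  obtain a b where ab: "a > 0" "b > 0" "\<forall>x. norm (ipU x x) \<le> a * norm (?L x)"
    "\<forall>x. norm (?L x) \<le> b * norm (ipU x x)"
    by (rule frame_norm_bounds[OF assms(1,4)])
  note ab = ab(1,2) ab(3,4)[rule_format]
  show ?thesis
  proof
    assume ?frame
    then obtain C D where fr: "continuous_star_g_frame_with_bounds \<mu> actU ipU actV ipV V \<Gamma> C D"
      unfolding continuous_star_g_frame_def by blast
    note intG = continuous_star_g_frame_with_boundsD(3)[OF fr]
    have intD: "strongly_integrable \<mu> (\<lambda>w. ipV (\<Lambda> w x - \<Gamma> w x) (\<Lambda> w x - \<Gamma> w x))" for x
      by (rule V.strongly_integrable_ip_diff[OF measL assms(6)[rule_format] intL intG])
    obtain c d where cd: "c > 0" "d > 0" "\<forall>x. norm (ipU x x) \<le> c * norm (?G x)"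
      "\<forall>x. norm (?G x) \<le> d * norm (ipU x x)"
      by (rule frame_norm_bounds[OF assms(1) fr])
    note cd = cd(1,2) cd(3,4)[rule_format]
    define M where "M = 2 + 2 * (b * c) + 2 * (d * a)"
    have bc: "0 < b * c" and da: "0 < d * a" using ab(1,2) cd(1,2) by simp_all
    have "norm (?D x) \<le> M * min (norm (?L x)) (norm (?G x))" for x
    proof -
      have D: "norm (?D x) \<le> 2 * norm (?L x) + 2 * norm (?G x)"
        by (rule V.norm_strong_integral_diff_le; rule has_strong_integral_strong_integral)
          (rule intL intG intD)+
      have LG: "norm (?L x) \<le> b * c * norm (?G x)"
        using order_trans[OF ab(4)[of x] mult_left_mono[OF cd(3)[of x]]] ab(2) by (simp add: mult.assoc)
      have GL: "norm (?G x) \<le> d * a * norm (?L x)"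
        using order_trans[OF cd(4)[of x] mult_left_mono[OF ab(3)[of x]]] cd(2) by (simp add: mult.assoc)
      have "norm (?D x) \<le> M * norm (?L x)"
        using D GL mult_nonneg_nonneg[OF less_imp_le[OF bc] norm_ge_zero[of "?L x"]]
        unfolding M_def distrib_right by linarith
      moreover have "norm (?D x) \<le> M * norm (?G x)"
        using D LG mult_nonneg_nonneg[OF less_imp_le[OF da] norm_ge_zero[of "?G x"]]
        unfolding M_def distrib_right by linarith
      ultimately show ?thesis by (simp add: min_def)
    qed
    moreover have "M > 0" using bc da by (simp add: M_def)
    ultimately show "\<exists>M::real. M > 0 \<and> ?perturb M"
      by (intro exI[of _ M] conjI allI intL intG intD)
  next
    assume "\<exists>M::real. M > 0 \<and> ?perturb M"
    then obtain M where M: "M > 0" and pert: "?perturb M" by blast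
    note pert = pert[rule_format]
    have intD: "strongly_integrable \<mu> (\<lambda>w. ipV (\<Lambda> w x - \<Gamma> w x) (\<Lambda> w x - \<Gamma> w x))" for x
      using pert by (rule conjunct1)
    have intG: "strongly_integrable \<mu> (\<lambda>w. ipV (\<Gamma> w x) (\<Gamma> w x))" for x
      using pert[THEN conjunct2, THEN conjunct2] by (rule conjunct1)
    have D: "norm (?D x) \<le> M * min (norm (?L x)) (norm (?G x))" for x
      using pert[THEN conjunct2, THEN conjunct2] by (rule conjunct2)
    have DL: "norm (?D x) \<le> M * norm (?L x)" and DG: "norm (?D x) \<le> M * norm (?G x)" for x
      using order_trans[OF D[of x] mult_left_mono[OF min.cobounded1]]
        order_trans[OF D[of x] mult_left_mono[OF min.cobounded2]] M by simp_all
    note has = has_strong_integral_strong_integral[OF intL]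
      has_strong_integral_strong_integral[OF intG] has_strong_integral_strong_integral[OF intD]
    have G: "norm (?G x) \<le> 2 * norm (?L x) + 2 * norm (?D x)" for x
      by (rule V.norm_strong_integral_diff_le[OF has(1,3)]) (simp add: has(2))
    \<comment> \<open>The second bound is the first with \<open>\<Lambda>\<close> and \<open>\<Gamma>\<close> exchanged; the integral of the
      difference does not change.\<close>
    have hasD': "has_strong_integral \<mu> (\<lambda>w. ipV (\<Gamma> w x - \<Lambda> w x) (\<Gamma> w x - \<Lambda> w x)) (?D x)" for x
    proof -
      have "ipV (\<Gamma> w x - \<Lambda> w x) (\<Gamma> w x - \<Lambda> w x) = ipV (\<Lambda> w x - \<Gamma> w x) (\<Lambda> w x - \<Gamma> w x)" for w
        by (simp add: V.ip_diff_left V.ip_diff_right)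
      then show ?thesis using has(3) by simp
    qed
    have L: "norm (?L x) \<le> 2 * norm (?G x) + 2 * norm (?D x)" for x
      by (rule V.norm_strong_integral_diff_le[OF has(2) hasD']) (simp add: has(1))
    show ?frame
    proof (rule frame_of_norm_bounds[OF assms(1,2,5,6) intG])
      fix x
      have "norm (?L x) \<le> (2 + 2 * M) * norm (?G x)"
        using L[of x] DG[of x] unfolding distrib_right mult.assoc by linarith
      then have "a * norm (?L x) \<le> a * ((2 + 2 * M) * norm (?G x))"
        using ab(1) by (intro mult_left_mono) auto
      then show "norm (ipU x x) \<le> a * (2 + 2 * M) * norm (?G x)"
        using ab(3)[of x] by (simp add: mult.assoc)
      have "norm (?G x) \<le> (2 + 2 * M) * norm (?L x)"
        using G[of x] DL[of x] unfolding distrib_right mult.assoc by linarith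
      also have "\<dots> \<le> (2 + 2 * M) * (b * norm (ipU x x))"
        using ab(4)[of x] M by (intro mult_left_mono) auto
      finally show "norm (?G x) \<le> (2 + 2 * M) * b * norm (ipU x x)" by (simp add: mult.assoc)
    next
      show "0 < a * (2 + 2 * M)" "0 < (2 + 2 * M) * b"
        using ab(1,2) M by (auto intro!: mult_pos_pos)
    qed
  qed
qed

end
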